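(* Let $N\geq2$, $\Lambda>0$, $\varepsilon>0$ and $0<m<M$. Let $K\in\mathcal{K}^N$ be a $(\Lambda,\varepsilon)$-q.m.p.c.c. with $B_m(z)\subset K\subset B_M(z)$ for some $z\in\mathbb{R}^N$. Then there exists $h\in C^{1,1}(\partial B)$ such that, up to a translation, \[K=\{tx(1+h(x)) : t\in[0,1],\ x\in\partial B\},\qquad \|h\|_{C^{1,1}(\partial B)}\leq C,\] where $C=C(N,\Lambda,\varepsilon,m,M)>0$ depends only on the indicated parameters.
   Context: $B$ is the open unit ball centered at $0$ and $B_r(z)$ the ball of radius $r$ centered at $z$. $\mathcal{K}^N$ is the class of convex bodies (compact convex sets with non-empty interior) of $\mathbb{R}^N$. A set $K\in\mathcal{K}^N$ is a $(\Lambda,\varepsilon)$-quasi-minimizer of the perimeter under convexity constraint ($(\Lambda,\varepsilon)$-q.m.p.c.c.) if for every $\widetilde{K}\in\mathcal{K}^N$ with $\widetilde{K}\subset K$ and $|K\setminus\widetilde{K}|\leq\varepsilon$ one has $P(K)\leq P(\widetilde{K})+\Lambda|K\setminus\widetilde{K}|$, where $P$ is perimeter. *)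

theory Defs
  imports "HOL-Analysis.Analysis"
begin

definition convex_body :: "'a::euclidean_space set \<Rightarrow> bool" where
  "convex_body K \<longleftrightarrow> compact K \<and> convex K \<and> interior K \<noteq> {}"

definition divergence :: "('a::euclidean_space \<Rightarrow> 'a) \<Rightarrow> 'a \<Rightarrow> real" where
  "divergence \<phi> x = (\<Sum>i\<in>Basis. frechet_derivative \<phi> (at x) i \<bullet> i)"

definition test_field :: "('a::euclidean_space \<Rightarrow> 'a) \<Rightarrow> bool" where
  "test_field \<phi> \<longleftrightarrow> \<phi> differentiable_on UNIV
     \<and> (\<forall>i\<in>Basis. continuous_on UNIV (\<lambda>x. frechet_derivative \<phi> (at x) i))
     \<and> compact (closure {x. \<phi> x \<noteq> 0})
     \<and> (\<forall>x. norm (\<phi> x) \<le> 1)"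

definition perimeter :: "'a::euclidean_space set \<Rightarrow> real" where
  "perimeter E = (SUP \<phi>\<in>{\<phi>. test_field \<phi>}. integral E (divergence \<phi>))"

definition qmpcc :: "real \<Rightarrow> real \<Rightarrow> 'a::euclidean_space set \<Rightarrow> bool" where
  "qmpcc \<Lambda> \<epsilon> K \<longleftrightarrow> convex_body K \<and>
     (\<forall>K'. convex_body K' \<and> K' \<subseteq> K \<and> measure lebesgue (K - K') \<le> \<epsilon> \<longrightarrow>
        perimeter K \<le> perimeter K' + \<Lambda> * measure lebesgue (K - K'))"

text \<open>Tangential gradient of h on the unit sphere: gradient of its 0-homogeneous extension.\<close>
definition tangential_grad :: "('a::euclidean_space \<Rightarrow> real) \<Rightarrow> 'a \<Rightarrow> 'a" where
  "tangential_grad h x = (\<Sum>i\<in>Basis. frechet_derivative (\<lambda>y. h (y /\<^sub>R norm y)) (at x) i *\<^sub>R i)"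

definition C11_sphere_bound :: "('a::euclidean_space \<Rightarrow> real) \<Rightarrow> real \<Rightarrow> bool" where
  "C11_sphere_bound h C \<longleftrightarrow>
     (\<forall>x\<in>sphere 0 1. (\<lambda>y. h (y /\<^sub>R norm y)) differentiable (at x)) \<and>
     (\<exists>A B L. A + B + L \<le> C \<and>
        (\<forall>x\<in>sphere 0 1. \<bar>h x\<bar> \<le> A) \<and>
        (\<forall>x\<in>sphere 0 1. norm (tangential_grad h x) \<le> B) \<and>
        (\<forall>x\<in>sphere 0 1. \<forall>y\<in>sphere 0 1.
            norm (tangential_grad h x - tangential_grad h y) \<le> L * norm (x - y)))"

end

theory Submission
  imports Defs
begin

text \<open>
  Let \<open>D\<close> be the cap cut from \<open>K\<close> by a half-space with outer normal \<open>\<nu>\<close>, of height at least \<open>h\<close>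
  and contained in a strip of half-width \<open>r\<close> in a direction \<open>f\<close> orthogonal to \<open>\<nu>\<close>. A test field for
  the truncated body, continued into \<open>D\<close> by the unit field \<open>cos \<alpha> \<nu> + sin \<alpha> f\<close>, whose angle
  \<open>\<alpha>\<close> grows linearly across the strip, shows that cutting off \<open>D\<close> decreases the perimeter by at
  least \<open>\<theta> (1/(2r) - 4 \<theta> N/h) |D|\<close> for every small \<open>\<theta>\<close>. Quasi-minimality
  therefore forces \<open>h \<le> C r\<^sup>2\<close>.

  Let \<open>g\<close> be the gauge of \<open>K\<close>, and let \<open>\<xi>0\<close>, \<open>\<xi>1\<close> be subgradients of \<open>g\<close> at points \<open>x0\<close>, \<open>x1\<close>
  with \<open>g x0 = 1\<close> and \<open>|x0 - x1| \<le> r\<close>. Put \<open>\<tau> = |\<xi>1 - \<xi>0| r\<close> and cut \<open>K\<close> along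
  \<open>(\<xi>0 + \<xi>1)/2 = 1 - \<tau>\<close>. On this cap both linear forms lie between \<open>1 - 2\<tau>\<close> and \<open>1\<close>, so the cap has
  width of order \<open>r\<close> in the direction \<open>\<xi>1 - \<xi>0\<close>, while its height at \<open>x0\<close> is of order \<open>\<tau>\<close>. Hence
  \<open>|\<xi>1 - \<xi>0| \<le> C r\<close>: the gauge is \<open>C\<^sup>1\<^sup>,\<^sup>1\<close>, and so is the radial function \<open>1/g\<close> on the sphere.
\<close>

subsection \<open>Test fields\<close>

definition hinge2 :: "real \<Rightarrow> real" where "hinge2 t = (max 0 t)\<^sup>2"

lemma hinge2_deriv: "(hinge2 has_real_derivative 2 * max 0 t) (at t)"
proof -
  consider "t > 0" | "t < 0" | "t = 0" by linarith
  then show ?thesis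
  proof cases
    case 1
    have "((\<lambda>t. t\<^sup>2) has_real_derivative 2 * t) (at t)" by (auto intro!: derivative_eq_intros)
    then have "(hinge2 has_real_derivative 2 * t) (at t)"
      by (rule has_field_derivative_transform_within_open[where S="{0<..}"]) (use 1 in \<open>auto simp: hinge2_def\<close>)
    then show ?thesis using 1 by simp
  next
    case 2
    have "((\<lambda>t. 0) has_real_derivative 0) (at t)" by simp
    then have "(hinge2 has_real_derivative 0) (at t)"
      by (rule has_field_derivative_transform_within_open[where S="{..<0}"]) (use 2 in \<open>auto simp: hinge2_def\<close>)
    then show ?thesis using 2 by simp
  next
    case 3
    have "((\<lambda>h. max 0 h * max 0 h / h) \<longlongrightarrow> 0) (at (0::real))"
    proof (rule Lim_null_comparison)
      show "\<forall>\<^sub>F h in at (0::real). norm (max 0 h * max 0 h / h) \<le> \<bar>h\<bar>"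
        by (intro always_eventually) (auto simp: max_def)
      show "((\<lambda>h. \<bar>h\<bar>) \<longlongrightarrow> (0::real)) (at 0)" by (auto intro!: tendsto_eq_intros)
    qed
    then show ?thesis using 3 by (simp add: has_field_derivative_iff hinge2_def power2_eq_square)
  qed
qed

text \<open>A quadratic spline suffices, since test fields only have to be C^1. The weights 2, -4, 2
  cancel the quadratic and linear parts for \<open>t \<ge> 1\<close> and leave the constant 1; the
  derivative is a tent of height 2.\<close>

definition smoothstep :: "real \<Rightarrow> real" where
  "smoothstep t = 2 * hinge2 t - 4 * hinge2 (t - 1/2) + 2 * hinge2 (t - 1)"

definition smoothstep' :: "real \<Rightarrow> real" where
  "smoothstep' t = 4 * max 0 t - 8 * max 0 (t - 1/2) + 4 * max 0 (t - 1)"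

lemma smoothstep_deriv: "(smoothstep has_real_derivative smoothstep' t) (at t)"
  unfolding smoothstep_def[abs_def] smoothstep'_def
  by (auto intro!: derivative_eq_intros DERIV_chain2[OF hinge2_deriv])

lemma smoothstep_low: "t \<le> 0 \<Longrightarrow> smoothstep t = 0"
  by (simp add: smoothstep_def hinge2_def)

lemma smoothstep_high: "t \<ge> 1 \<Longrightarrow> smoothstep t = 1"
  by (simp add: smoothstep_def hinge2_def power2_eq_square algebra_simps)

lemma smoothstep'_low: "t \<le> 0 \<Longrightarrow> smoothstep' t = 0"
  by (simp add: smoothstep'_def)

lemma smoothstep'_high: "t \<ge> 1 \<Longrightarrow> smoothstep' t = 0"
  by (simp add: smoothstep'_def)

lemma smoothstep'_nonneg: "0 \<le> smoothstep' t"
  by (simp add: smoothstep'_def max_def)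

lemma smoothstep'_le: "smoothstep' t \<le> 2"
  by (simp add: smoothstep'_def max_def)

lemma smoothstep_range: "0 \<le> smoothstep t" "smoothstep t \<le> 1"
proof -
  have m: "smoothstep s \<le> smoothstep t" if "s \<le> t" for s t
    using DERIV_nonneg_imp_nondecreasing[OF that] smoothstep_deriv smoothstep'_nonneg by blast
  show "0 \<le> smoothstep t" using m[of "min t 0" t] smoothstep_low[of "min t 0"] by simp
  show "smoothstep t \<le> 1" using m[of t "max t 1"] smoothstep_high[of "max t 1"] by simp
qed

lemma continuous_smoothstep' [continuous_intros]:
  "continuous_on S f \<Longrightarrow> continuous_on S (\<lambda>x. smoothstep' (f x))"
  unfolding smoothstep'_def by (intro continuous_intros)

section \<open>Calculus of C^1 vector fields and their divergence\<close>

definition c1_field :: "('a::euclidean_space \<Rightarrow> 'a) \<Rightarrow> bool" where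
  "c1_field \<phi> \<longleftrightarrow> \<phi> differentiable_on UNIV
     \<and> (\<forall>i\<in>Basis. continuous_on UNIV (\<lambda>x. frechet_derivative \<phi> (at x) i))"

definition c1_grad :: "('a::euclidean_space \<Rightarrow> real) \<Rightarrow> ('a \<Rightarrow> 'a) \<Rightarrow> bool" where
  "c1_grad f g \<longleftrightarrow> (\<forall>x. (f has_derivative (\<lambda>v. g x \<bullet> v)) (at x)) \<and> continuous_on UNIV g"

lemma c1_fieldD: "c1_field \<phi> \<Longrightarrow> (\<phi> has_derivative frechet_derivative \<phi> (at x)) (at x)"
  unfolding c1_field_def differentiable_on_def by (simp add: frechet_derivative_works)

lemma c1_fieldI:
  assumes "\<And>x. (\<phi> has_derivative \<phi>' x) (at x)" "\<And>i. i \<in> Basis \<Longrightarrow> continuous_on UNIV (\<lambda>x. \<phi>' x i)"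
  shows "c1_field \<phi>" "divergence \<phi> x = (\<Sum>i\<in>Basis. \<phi>' x i \<bullet> i)"
proof -
  have "frechet_derivative \<phi> (at x) = \<phi>' x" for x using frechet_derivative_at[OF assms(1)] by simp
  then show "c1_field \<phi>" "divergence \<phi> x = (\<Sum>i\<in>Basis. \<phi>' x i \<bullet> i)"
    using assms by (auto simp: c1_field_def divergence_def differentiable_on_def differentiable_def
      has_derivative_at_withinI)
qed

lemma continuous_on_divergence: "c1_field \<phi> \<Longrightarrow> continuous_on S (divergence \<phi>)"
  unfolding divergence_def[abs_def] c1_field_def
  by (intro continuous_intros) (auto intro: continuous_on_subset)

lemma continuous_on_c1_field: "c1_field \<phi> \<Longrightarrow> continuous_on S \<phi>"
  unfolding c1_field_def using differentiable_imp_continuous_on continuous_on_subset by blast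

lemma continuous_on_c1_grad: "c1_grad f g \<Longrightarrow> continuous_on S f"
  unfolding c1_grad_def by (meson continuous_at_imp_continuous_on has_derivative_continuous)

lemma c1_field_const: "c1_field (\<lambda>x. v)" "divergence (\<lambda>x. v) x = 0"
  using c1_fieldI[of "\<lambda>x. v" "\<lambda>x w. 0"] by auto

lemma c1_field_add:
  assumes "c1_field \<phi>" "c1_field \<psi>"
  shows "c1_field (\<lambda>x. \<phi> x + \<psi> x)" "divergence (\<lambda>x. \<phi> x + \<psi> x) x = divergence \<phi> x + divergence \<psi> x"
proof -
  have d: "((\<lambda>x. \<phi> x + \<psi> x) has_derivative
      (\<lambda>v. frechet_derivative \<phi> (at x) v + frechet_derivative \<psi> (at x) v)) (at x)" for x
    using assms by (intro has_derivative_add c1_fieldD)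
  have c: "continuous_on UNIV (\<lambda>x. frechet_derivative \<phi> (at x) i + frechet_derivative \<psi> (at x) i)"
    if "i \<in> Basis" for i
    using assms that by (intro continuous_intros) (auto simp: c1_field_def)
  show "c1_field (\<lambda>x. \<phi> x + \<psi> x)" "divergence (\<lambda>x. \<phi> x + \<psi> x) x = divergence \<phi> x + divergence \<psi> x"
    using c1_fieldI[OF d c] by (auto simp: divergence_def inner_add_left sum.distrib)
qed

lemma c1_field_scale:
  assumes "c1_field \<phi>" "c1_grad f g"
  shows "c1_field (\<lambda>x. f x *\<^sub>R \<phi> x)"
    "divergence (\<lambda>x. f x *\<^sub>R \<phi> x) x = f x * divergence \<phi> x + g x \<bullet> \<phi> x"
proof -
  have d: "((\<lambda>x. f x *\<^sub>R \<phi> x) has_derivative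
      (\<lambda>v. f x *\<^sub>R frechet_derivative \<phi> (at x) v + (g x \<bullet> v) *\<^sub>R \<phi> x)) (at x)" for x
    using assms by (intro has_derivative_scaleR c1_fieldD) (auto simp: c1_grad_def)
  have c: "continuous_on UNIV (\<lambda>x. f x *\<^sub>R frechet_derivative \<phi> (at x) i + (g x \<bullet> i) *\<^sub>R \<phi> x)"
    if "i \<in> Basis" for i
    using assms that
    by (intro continuous_intros continuous_on_c1_field[OF assms(1)] continuous_on_c1_grad[OF assms(2)])
       (auto simp: c1_field_def c1_grad_def)
  have "(\<Sum>i\<in>Basis. (g x \<bullet> i) * (\<phi> x \<bullet> i)) = g x \<bullet> \<phi> x"
    by (rule euclidean_inner[symmetric])
  then show "c1_field (\<lambda>x. f x *\<^sub>R \<phi> x)"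
    "divergence (\<lambda>x. f x *\<^sub>R \<phi> x) x = f x * divergence \<phi> x + g x \<bullet> \<phi> x"
    using c1_fieldI[OF d c] by (auto simp: divergence_def inner_add_left sum.distrib sum_distrib_left)
qed

lemma c1_grad_compose:
  assumes "c1_grad f g" "\<And>t. (F has_real_derivative F' t) (at t)" "continuous_on UNIV F'"
  shows "c1_grad (\<lambda>x. F (f x)) (\<lambda>x. F' (f x) *\<^sub>R g x)"
  unfolding c1_grad_def
proof (intro conjI allI)
  fix x
  have "(f has_derivative (\<lambda>v. g x \<bullet> v)) (at x)" using assms(1) by (simp add: c1_grad_def)
  from has_derivative_compose[OF this assms(2)[unfolded has_field_derivative_def]]
  show "((\<lambda>x. F (f x)) has_derivative (\<lambda>v. (F' (f x) *\<^sub>R g x) \<bullet> v)) (at x)" by simp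
  have "continuous_on UNIV (\<lambda>x. F' (f x))"
    using continuous_on_compose2[OF assms(3) continuous_on_c1_grad[OF assms(1), of UNIV]] by auto
  then show "continuous_on UNIV (\<lambda>x. F' (f x) *\<^sub>R g x)"
    using assms(1) by (intro continuous_intros) (auto simp: c1_grad_def)
qed

lemma c1_grad_linear: "c1_grad (\<lambda>x. \<nu> \<bullet> x) (\<lambda>x. \<nu>)"
  unfolding c1_grad_def by (auto intro!: derivative_eq_intros)

lemma c1_grad_square: "c1_grad (\<lambda>x. x \<bullet> x) (\<lambda>x. 2 *\<^sub>R x)"
  unfolding c1_grad_def by (auto intro!: derivative_eq_intros continuous_intros simp: inner_commute)

lemma c1_grad_mult:
  assumes "c1_grad f g" "c1_grad f2 g2"
  shows "c1_grad (\<lambda>x. f x * f2 x) (\<lambda>x. f x *\<^sub>R g2 x + f2 x *\<^sub>R g x)"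
  unfolding c1_grad_def
proof (intro conjI allI)
  fix x
  have "((\<lambda>x. f x * f2 x) has_derivative (\<lambda>v. f x * (g2 x \<bullet> v) + (g x \<bullet> v) * f2 x)) (at x)"
    using assms by (intro has_derivative_mult) (auto simp: c1_grad_def)
  then show "((\<lambda>x. f x * f2 x) has_derivative (\<lambda>v. (f x *\<^sub>R g2 x + f2 x *\<^sub>R g x) \<bullet> v)) (at x)"
    by (simp add: inner_add_left mult.commute)
  show "continuous_on UNIV (\<lambda>x. f x *\<^sub>R g2 x + f2 x *\<^sub>R g x)"
    using assms by (intro continuous_intros continuous_on_c1_grad[OF assms(1)] continuous_on_c1_grad[OF assms(2)])
      (auto simp: c1_grad_def)
qed

lemma test_field_iff: "test_field \<phi> \<longleftrightarrow> c1_field \<phi> \<and> bounded {x. \<phi> x \<noteq> 0} \<and> (\<forall>x. norm (\<phi> x) \<le> 1)"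
  by (auto simp: test_field_def c1_field_def compact_closure)

lemma integrable_continuous_compact:
  fixes f :: "'a::euclidean_space \<Rightarrow> 'b::euclidean_space"
  assumes "compact K" "continuous_on K f"
  shows "f integrable_on K" "set_integrable lborel K f"
  using borel_integrable_compact[OF assms] set_borel_integral_eq_integral(1)[of K f]
  by (auto simp: set_integrable_def)

text \<open>Turns the integral of a difference quotient over \<open>K\<close> into a difference of
  integrals over a translate of \<open>K\<close> and \<open>K\<close> itself. Translation invariance
  is that of \<open>lborel\<close>, hence the detour through Lebesgue integrals of
  indicators.\<close>

lemma integral_translate_compact:
  fixes f :: "'a::euclidean_space \<Rightarrow> real"
  assumes K: "compact K" and f: "continuous_on UNIV f"
  shows "integral K (\<lambda>x. f (v + x)) = integral ((+) v ` K) f"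
proof -
  have K': "compact ((+) v ` K)" using K by (rule compact_translation)
  have "continuous_on K (\<lambda>x. f (v + x))"
    by (rule continuous_on_compose2[OF f]) (auto intro!: continuous_intros)
  then have "integral K (\<lambda>x. f (v + x)) = (LINT x|lborel. indicator K x *\<^sub>R f (v + x))"
    using set_borel_integral_eq_integral(2)[OF integrable_continuous_compact(2)[OF K, of "\<lambda>x. f (v + x)"]]
    by (simp add: set_lebesgue_integral_def)
  also have "\<dots> = (LINT x|lborel. indicator ((+) v ` K) (v + x) *\<^sub>R f (v + x))"
    by (intro Bochner_Integration.integral_cong) (auto simp: indicator_def)
  also have "\<dots> = (LINT y|distr lborel borel ((+) v). indicator ((+) v ` K) y *\<^sub>R f y)"
  proof (rule integral_distr[symmetric])
    show "(+) v \<in> lborel \<rightarrow>\<^sub>M borel" by simp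
    have "(+) v ` K \<in> sets borel" using K' by (simp add: borel_compact)
    then show "(\<lambda>y. indicator ((+) v ` K) y *\<^sub>R f y) \<in> borel_measurable borel"
      using borel_measurable_continuous_onI[OF f] by simp
  qed
  also have "\<dots> = (LINT y|lborel. indicator ((+) v ` K) y *\<^sub>R f y)"
    using lborel_distr_plus[of v] by simp
  also have "\<dots> = integral ((+) v ` K) f"
    using set_borel_integral_eq_integral(2)[OF integrable_continuous_compact(2)[OF K', of f]]
      continuous_on_subset[OF f] by (auto simp: set_lebesgue_integral_def)
  finally show ?thesis .
qed

subsection \<open>Finiteness of the perimeter of a convex body\<close>

text \<open>The limit is the derivative of the power at 0. It turns the volume growth of a dilation
  into a rate, once with the radius of an inner ball as \<open>m\<close> and once with the height of
  a cap.\<close>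

lemma power_quotient_tendsto:
  assumes "m \<noteq> 0"
  shows "((\<lambda>h. ((1 + h / m) ^ N - 1) / h) \<longlongrightarrow> real N / m) (at (0::real))"
proof -
  have "((\<lambda>h. (1 + h / m) ^ N) has_real_derivative real N / m) (at 0)"
    using assms by (auto intro!: derivative_eq_intros)
  then show ?thesis by (simp add: has_field_derivative_iff)
qed

lemma cball_subset_closed:
  fixes K :: "'a::euclidean_space set"
  assumes "closed K" "ball z m \<subseteq> K" "m > 0"
  shows "cball z m \<subseteq> K"
  using closure_minimal[OF assms(2,1)] assms(3) by simp

text \<open>Write \<open>v = s (w - z)\<close> with \<open>w\<close> in the closed inner ball. Then
  \<open>v + k = (1 + s) x - s z\<close> for the convex combination
  \<open>x = (k + s w) / (1 + s)\<close>.\<close>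

lemma translate_subset_dilation:
  fixes K :: "'a::euclidean_space set"
  assumes K: "closed K" "convex K" and m: "ball z m \<subseteq> K" "m > 0" and s: "s > 0" and v: "norm v \<le> s * m"
  shows "(+) v ` K \<subseteq> (\<lambda>x. (1 + s) *\<^sub>R x + (- s) *\<^sub>R z) ` K"
proof safe
  fix k assume k: "k \<in> K"
  define w where "w = z + v /\<^sub>R s"
  have "w \<in> cball z m"
    using v s by (auto simp: w_def dist_norm field_simps)
  then have w: "w \<in> K" using cball_subset_closed[OF K(1) m] by blast
  define x where "x = (1 / (1 + s)) *\<^sub>R k + (s / (1 + s)) *\<^sub>R w"
  have "x \<in> K" unfolding x_def
    by (rule convexD[OF K(2) k w]) (use s in \<open>auto simp: field_simps\<close>)
  moreover have "(1 + s) *\<^sub>R x = k + s *\<^sub>R w"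
    using s by (simp add: x_def scaleR_add_right)
  then have "(1 + s) *\<^sub>R x + (- s) *\<^sub>R z = v + k"
    using s by (simp add: w_def scaleR_add_right)
  ultimately show "v + k \<in> (\<lambda>x. (1 + s) *\<^sub>R x + (- s) *\<^sub>R z) ` K"
    by (metis image_eqI)
qed

text \<open>Both \<open>1 + g\<close> and \<open>1 - g\<close> are nonnegative, so their integrals
  over \<open>A\<close> and \<open>B\<close> only grow when the domains are enlarged to
  \<open>E\<close>, where the two integrands add up to 2.\<close>

lemma integral_diff_le_measure:
  fixes g :: "'a::euclidean_space \<Rightarrow> real"
  assumes c: "compact A" "compact B" "compact E" and s: "A \<subseteq> E" "B \<subseteq> E"
    and g: "continuous_on UNIV g" "\<And>x. \<bar>g x\<bar> \<le> 1"
  shows "integral A g - integral B g \<le> 2 * measure lebesgue E - measure lebesgue A - measure lebesgue B"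
proof -
  have i: "g integrable_on S" if "compact S" for S
    using integrable_continuous_compact(1)[OF that] continuous_on_subset[OF g(1)] by blast
  have o: "(\<lambda>x. 1::real) integrable_on S" if "compact S" for S :: "'a set"
    using lmeasurable_compact[OF that] integrable_on_const by blast
  have m: "measure lebesgue S = integral S (\<lambda>x. 1)" if "compact S" for S :: "'a set"
    using lmeasurable_compact[OF that] lmeasure_integral by blast
  have gb: "0 \<le> 1 + g x" "g x \<le> 1" for x using g(2)[of x] by linarith+
  have "integral A (\<lambda>x. 1 + g x) \<le> integral E (\<lambda>x. 1 + g x)"
    using c s i o gb by (intro integral_subset_le integrable_add) auto
  moreover have "integral B (\<lambda>x. 1 - g x) \<le> integral E (\<lambda>x. 1 - g x)"
    using c s i o gb by (intro integral_subset_le integrable_diff) auto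
  ultimately show ?thesis
    using c i o m by (simp add: Henstock_Kurzweil_Integration.integral_add Henstock_Kurzweil_Integration.integral_diff)
qed

lemma c1_field_component_deriv:
  assumes "c1_field \<phi>"
  shows "((\<lambda>t. \<phi> (x + t *\<^sub>R i) \<bullet> j) has_real_derivative frechet_derivative \<phi> (at (x + t *\<^sub>R i)) i \<bullet> j) (at t)"
proof -
  let ?D = "frechet_derivative \<phi> (at (x + t *\<^sub>R i))"
  have "(\<phi> has_derivative ?D) (at (x + t *\<^sub>R i))" using assms by (rule c1_fieldD)
  moreover have "((\<lambda>t. x + t *\<^sub>R i) has_derivative (\<lambda>h. h *\<^sub>R i)) (at t)"
    by (auto intro!: derivative_eq_intros)
  ultimately have "((\<lambda>t. \<phi> (x + t *\<^sub>R i)) has_derivative (\<lambda>h. ?D (h *\<^sub>R i))) (at t)"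
    using has_derivative_compose by blast
  then have "((\<lambda>t. \<phi> (x + t *\<^sub>R i) \<bullet> j) has_derivative (\<lambda>h. ?D (h *\<^sub>R i) \<bullet> j)) (at t)"
    by (rule has_derivative_inner_left)
  moreover have "linear ?D"
    using c1_fieldD[OF assms] has_derivative_linear by blast
  ultimately show ?thesis
    by (simp add: has_field_derivative_def linear_cmul mult_commute_abs)
qed

text \<open>The integral is the limit of \<open>(\<integral> over K + s i of \<phi>_i - \<integral> over K of \<phi>_i) / s\<close>, and both \<open>K + s i\<close> and
  \<open>K\<close> lie in the dilation of \<open>K\<close> by \<open>1 + s/m\<close> about \<open>z\<close>.\<close>
lemma integral_partial_derivative_le:
  fixes K :: "'a::euclidean_space set"
  assumes K: "compact K" "convex K" and m: "ball z m \<subseteq> K" "m > 0"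
    and \<phi>: "test_field \<phi>" and i: "i \<in> Basis"
  shows "(\<lambda>x. frechet_derivative \<phi> (at x) i \<bullet> i) integrable_on K"
    "integral K (\<lambda>x. frechet_derivative \<phi> (at x) i \<bullet> i) \<le> 2 * measure lebesgue K * (real DIM('a) / m)"
proof -
  have c1: "c1_field \<phi>" and n1: "\<And>x. norm (\<phi> x) \<le> 1" using \<phi> by (auto simp: test_field_iff)
  have cD: "continuous_on S (\<lambda>x. frechet_derivative \<phi> (at x) i \<bullet> i)" for S
  proof -
    have "continuous_on UNIV (\<lambda>x. frechet_derivative \<phi> (at x) i)"
      using c1 i unfolding c1_field_def by blast
    then have "continuous_on S (\<lambda>x. frechet_derivative \<phi> (at x) i)"
      by (rule continuous_on_subset) simp
    then show ?thesis by (intro continuous_on_inner continuous_on_const)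
  qed
  define s where "s k = inverse (real (Suc k))" for k
  have s: "s k > 0" "s k \<le> 1" for k by (auto simp: s_def field_simps)
  have s_at: "filterlim s (at 0) sequentially"
    using LIMSEQ_inverse_real_of_nat by (simp add: filterlim_at s_def[abs_def])
  define q where "q k x = (\<phi> (x + s k *\<^sub>R i) \<bullet> i - \<phi> x \<bullet> i) / s k" for k x
  obtain R where R: "K \<subseteq> cball 0 R" using compact_imp_bounded[OF K(1)] by (auto simp: bounded_iff subset_iff)
  \<comment> \<open>The segments from \<open>x\<close> to \<open>x + s k *\<^sub>R i\<close> leave
    \<open>K\<close> by at most 1, so by the mean value theorem a bound on this larger ball
    dominates all difference quotients.\<close>
  have "bounded ((\<lambda>x. frechet_derivative \<phi> (at x) i \<bullet> i) ` cball 0 (R + 1))"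
    by (rule compact_imp_bounded[OF compact_continuous_image[OF cD compact_cball]])
  then obtain S where S: "\<And>x. x \<in> cball 0 (R + 1) \<Longrightarrow> \<bar>frechet_derivative \<phi> (at x) i \<bullet> i\<bar> \<le> S"
    unfolding bounded_iff by fastforce
  let ?g = "\<lambda>x. \<phi> x \<bullet> i"
  have cg: "continuous_on S ?g" for S
    using c1 by (intro continuous_intros continuous_on_c1_field)
  have cg': "continuous_on S (\<lambda>x. ?g (x + v))" for S v
    by (rule continuous_on_compose2[OF cg[of UNIV]]) (auto intro!: continuous_intros)
  have q_int: "q k integrable_on K" for k
    unfolding q_def[abs_def]
    by (intro integrable_continuous_compact K continuous_intros cg cg') (use s(1)[of k] in auto)
  have q_bound: "norm (q k x) \<le> S" if "x \<in> K" for k x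
  proof -
    obtain t where t: "0 < t" "t < s k"
      "\<phi> (x + s k *\<^sub>R i) \<bullet> i - \<phi> (x + 0 *\<^sub>R i) \<bullet> i = (s k - 0) * (frechet_derivative \<phi> (at (x + t *\<^sub>R i)) i \<bullet> i)"
      using MVT2[OF s(1)[of k], of "\<lambda>t. \<phi> (x + t *\<^sub>R i) \<bullet> i" "\<lambda>t. frechet_derivative \<phi> (at (x + t *\<^sub>R i)) i \<bullet> i"]
        c1_field_component_deriv[OF c1] by blast
    have "norm (x + t *\<^sub>R i) \<le> norm x + t" using norm_triangle_ineq[of x "t *\<^sub>R i"] i t(1) by simp
    also have "\<dots> \<le> R + 1" using R that t(2) s(2)[of k] by force
    finally have "\<bar>frechet_derivative \<phi> (at (x + t *\<^sub>R i)) i \<bullet> i\<bar> \<le> S" by (intro S) simp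
    then show ?thesis using t s(1)[of k] by (simp add: q_def)
  qed
  have q_conv: "(\<lambda>k. q k x) \<longlonglongrightarrow> frechet_derivative \<phi> (at x) i \<bullet> i" for x
  proof -
    have "((\<lambda>h. (\<phi> (x + h *\<^sub>R i) \<bullet> i - \<phi> x \<bullet> i) / h) \<longlongrightarrow> frechet_derivative \<phi> (at x) i \<bullet> i) (at 0)"
      using c1_field_component_deriv[OF c1, of x i i 0] by (simp add: has_field_derivative_iff)
    from filterlim_compose[OF this s_at] show ?thesis by (simp add: q_def)
  qed
  have h_int: "(\<lambda>x. S) integrable_on K" using lmeasurable_compact[OF K(1)] by (rule integrable_on_const)
  show "(\<lambda>x. frechet_derivative \<phi> (at x) i \<bullet> i) integrable_on K"
    by (rule integrable_continuous_compact(1)[OF K(1) cD])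
  have lim: "(\<lambda>k. integral K (q k)) \<longlonglongrightarrow> integral K (\<lambda>x. frechet_derivative \<phi> (at x) i \<bullet> i)"
    by (rule dominated_convergence(2)[OF q_int h_int q_bound q_conv])
  have le: "integral K (q k) \<le> 2 * measure lebesgue K * (((1 + s k / m) ^ DIM('a) - 1) / s k)" for k
  proof -
    let ?E = "(\<lambda>x. (1 + s k / m) *\<^sub>R x + (- (s k / m)) *\<^sub>R z) ` K"
    have sm: "s k / m > 0" using s m by simp
    have E: "compact ?E" using K(1) by (intro compact_continuous_image continuous_intros)
    have v: "norm (s k *\<^sub>R i) \<le> s k / m * m" using i s(1)[of k] m by simp
    \<comment> \<open>The trivial translation shows that the dilated body also contains
      \<open>K\<close>.\<close>
    have "(+) 0 ` K \<subseteq> ?E"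
      using translate_subset_dilation[OF compact_imp_closed[OF K(1)] K(2) m sm, of 0] less_imp_le[OF s(1)[of k]] m by simp
    then have KE: "K \<subseteq> ?E" by simp
    have KE': "(+) (s k *\<^sub>R i) ` K \<subseteq> ?E"
      by (rule translate_subset_dilation[OF compact_imp_closed[OF K(1)] K(2) m sm v])
    have "\<bar>1 + s k / m\<bar> = 1 + s k / m" using sm by linarith
    then have mE: "measure lebesgue ?E = (1 + s k / m) ^ DIM('a) * measure lebesgue K"
      using measure_lebesgue_affine[of "1 + s k / m" "(- (s k / m)) *\<^sub>R z" K] by simp
    have mT: "measure lebesgue ((+) (s k *\<^sub>R i) ` K) = measure lebesgue K" by (rule measure_translation)
    have "integral K (q k) = (integral K (\<lambda>x. ?g (s k *\<^sub>R i + x)) - integral K ?g) / s k"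
      unfolding q_def[abs_def] using cg'[of K "s k *\<^sub>R i"] cg[of K]
      by (simp add: Henstock_Kurzweil_Integration.integral_diff integrable_continuous_compact K add.commute)
    also have "integral K (\<lambda>x. ?g (s k *\<^sub>R i + x)) = integral ((+) (s k *\<^sub>R i) ` K) ?g"
      by (rule integral_translate_compact[OF K(1) cg])
    also have "integral ((+) (s k *\<^sub>R i) ` K) ?g - integral K ?g \<le> 2 * measure lebesgue ?E - measure lebesgue ((+) (s k *\<^sub>R i) ` K) - measure lebesgue K"
    proof (rule integral_diff_le_measure[OF _ K(1) E KE' KE cg])
      show "compact ((+) (s k *\<^sub>R i) ` K)" using K(1) by (rule compact_translation)
      show "\<bar>?g x\<bar> \<le> 1" for x using Basis_le_norm[OF i, of "\<phi> x"] n1[of x] by linarith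
    qed
    finally show ?thesis using s(1)[of k] unfolding mE mT by (simp add: divide_right_mono algebra_simps)
  qed
  have "(\<lambda>k. 2 * measure lebesgue K * (((1 + s k / m) ^ DIM('a) - 1) / s k)) \<longlonglongrightarrow> 2 * measure lebesgue K * (real DIM('a) / m)"
    by (intro tendsto_mult tendsto_const filterlim_compose[OF power_quotient_tendsto s_at])
      (use m in simp)
  from LIMSEQ_le[OF lim this] le
  show "integral K (\<lambda>x. frechet_derivative \<phi> (at x) i \<bullet> i) \<le> 2 * measure lebesgue K * (real DIM('a) / m)"
    by blast
qed

text \<open>The supremum in \<open>perimeter\<close> is taken in the reals and is informative only
  for a set bounded above. The bound on a single partial derivative, summed over the coordinates,
  provides this.\<close>

lemma perimeter_bdd_above:
  fixes K :: "'a::euclidean_space set"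
  assumes "convex_body K"
  shows "bdd_above ((\<lambda>\<phi>. integral K (divergence \<phi>)) ` {\<phi>. test_field \<phi>})"
proof -
  have K: "compact K" "convex K" "interior K \<noteq> {}" using assms by (auto simp: convex_body_def)
  obtain z m where m: "ball z m \<subseteq> K" "m > 0" using K(3) by (auto simp: mem_interior)
  show ?thesis
  proof (rule bdd_aboveI2)
    fix \<phi> :: "'a \<Rightarrow> 'a" assume "\<phi> \<in> {\<phi>. test_field \<phi>}"
    then have \<phi>: "test_field \<phi>" by simp
    have "integral K (divergence \<phi>) = (\<Sum>i\<in>Basis. integral K (\<lambda>x. frechet_derivative \<phi> (at x) i \<bullet> i))"
      unfolding divergence_def[abs_def]
      by (intro integral_sum integral_partial_derivative_le[OF K(1,2) m \<phi>]) auto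
    also have "\<dots> \<le> (\<Sum>i\<in>(Basis::'a set). 2 * measure lebesgue K * (real DIM('a) / m))"
      by (intro sum_mono integral_partial_derivative_le[OF K(1,2) m \<phi>])
    finally show "integral K (divergence \<phi>) \<le> (\<Sum>i\<in>(Basis::'a set). 2 * measure lebesgue K * (real DIM('a) / m))" .
  qed
qed

lemma perimeter_upper:
  "convex_body K \<Longrightarrow> test_field \<phi> \<Longrightarrow> integral K (divergence \<phi>) \<le> perimeter K"
  unfolding perimeter_def by (rule cSUP_upper[OF _ perimeter_bdd_above]) auto

lemma perimeter_least:
  assumes "\<And>\<phi>. test_field \<phi> \<Longrightarrow> integral K (divergence \<phi>) \<le> c"
  shows "perimeter K \<le> c"
proof -
  \<comment> \<open>The zero field makes the family nonempty, as \<open>cSUP_least\<close>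
    requires.\<close>
  have "test_field (\<lambda>x. 0)" by (simp add: test_field_iff c1_field_const)
  then show ?thesis unfolding perimeter_def using assms by (intro cSUP_least) auto
qed

text \<open>Half-angle formula. The quadratic order is essential: tilting the field by an angle of
  order \<open>\<theta>\<close> loses order \<open>\<theta>\<^sup>2\<close> below the cap and gains
  order \<open>\<theta>\<close> inside it.\<close>

lemma one_minus_cos_le: "1 - cos x \<le> x\<^sup>2 / 2" for x :: real
proof -
  have "\<bar>sin (x / 2)\<bar>\<^sup>2 \<le> \<bar>x / 2\<bar>\<^sup>2" by (intro power_mono abs_sin_x_le_abs_x) auto
  moreover have "cos x = 1 - 2 * (sin (x / 2))\<^sup>2" using cos_double_sin[of "x / 2"] by simp
  ultimately show ?thesis by (simp add: power_divide)
qed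

section \<open>Caps of convex bodies and the glued test field\<close>

lemma convex_cap: "convex K \<Longrightarrow> convex (K \<inter> {x. c < \<nu> \<bullet> x})" for K :: "'a::euclidean_space set"
  by (intro convex_Int) (simp_all add: convex_halfspace_gt)

lemma measurable_cap:
  "compact K \<Longrightarrow> convex K \<Longrightarrow> K \<inter> {x. c < \<nu> \<bullet> x} \<in> lmeasurable" for K :: "'a::euclidean_space set"
  by (intro measurable_convex convex_cap) (auto intro: bounded_subset compact_imp_bounded)

text \<open>The homothety with centre \<open>p\<close> and ratio \<open>q\<close> maps the enlarged cap \<open>D'\<close> into \<open>D\<close>.\<close>
lemma cap_layer:
  fixes K :: "'a::euclidean_space set"
  assumes K: "compact K" "convex K" and p: "p \<in> K" "\<nu> \<bullet> p \<ge> c + h" and h: "h > 0" and d: "\<delta> > 0"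
  defines "D \<equiv> K \<inter> {x. c < \<nu> \<bullet> x}" and "D' \<equiv> K \<inter> {x. c - \<delta> < \<nu> \<bullet> x}" and "q \<equiv> h / (h + \<delta>)"
  shows "\<And>x. x \<in> D' \<Longrightarrow> q *\<^sub>R x + (1 - q) *\<^sub>R p \<in> D"
    and "measure lebesgue D' \<le> (1 + \<delta> / h) ^ DIM('a) * measure lebesgue D"
proof -
  have q: "0 < q" "q < 1" using h d by (auto simp: q_def field_simps)
  show im: "q *\<^sub>R x + (1 - q) *\<^sub>R p \<in> D" if x: "x \<in> D'" for x
  proof -
    have "q *\<^sub>R x + (1 - q) *\<^sub>R p \<in> K"
      using x q p by (intro convexD[OF K(2)]) (auto simp: D'_def)
    \<comment> \<open>The ratio \<open>q\<close> solves
      \<open>q (c - \<delta>) + (1 - q) (c + h) = c\<close>, so the lowest admissible level is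
      mapped exactly to the level of the cut.\<close>
    moreover have "c < q * (\<nu> \<bullet> x) + (1 - q) * (\<nu> \<bullet> p)"
    proof -
      have "q * (c - \<delta>) < q * (\<nu> \<bullet> x)" using x q by (auto simp: D'_def)
      moreover have "(1 - q) * (c + h) \<le> (1 - q) * (\<nu> \<bullet> p)" using p q by (intro mult_left_mono) auto
      moreover have "q * (h + \<delta>) = h" using h d by (simp add: q_def)
      ultimately show ?thesis by (simp add: algebra_simps)
    qed
    ultimately show ?thesis by (simp add: D_def inner_add_right)
  qed
  have sub: "(\<lambda>x. q *\<^sub>R x + (1 - q) *\<^sub>R p) ` D' \<subseteq> D" using im by blast
  have D: "D \<in> lmeasurable" unfolding D_def by (rule measurable_cap[OF K])
  have "convex D'" unfolding D'_def by (rule convex_cap[OF K(2)])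
  then have "convex ((+) ((1 - q) *\<^sub>R p) ` ((*\<^sub>R) q ` D'))"
    by (intro convex_translation convex_scaling)
  then have "convex ((\<lambda>x. q *\<^sub>R x + (1 - q) *\<^sub>R p) ` D')"
    by (simp add: image_image add.commute)
  moreover have "bounded ((\<lambda>x. q *\<^sub>R x + (1 - q) *\<^sub>R p) ` D')"
    using bounded_subset[OF _ sub] K(1) compact_imp_bounded bounded_subset unfolding D_def by blast
  ultimately have "(\<lambda>x. q *\<^sub>R x + (1 - q) *\<^sub>R p) ` D' \<in> lmeasurable" by (rule measurable_convex)
  then have "measure lebesgue ((\<lambda>x. q *\<^sub>R x + (1 - q) *\<^sub>R p) ` D') \<le> measure lebesgue D"
    using sub D by (intro measure_mono_fmeasurable) auto
  then have "q ^ DIM('a) * measure lebesgue D' \<le> measure lebesgue D"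
    using measure_lebesgue_affine[of q "(1 - q) *\<^sub>R p" D'] q by simp
  then have "(1 / q) ^ DIM('a) * (q ^ DIM('a) * measure lebesgue D') \<le> (1 / q) ^ DIM('a) * measure lebesgue D"
    using q by (intro mult_left_mono) auto
  also have "(1 / q) ^ DIM('a) * (q ^ DIM('a) * measure lebesgue D') = measure lebesgue D'"
    using q by (simp add: power_divide)
  also have "1 / q = 1 + \<delta> / h" using h d by (simp add: q_def field_simps)
  finally show "measure lebesgue D' \<le> (1 + \<delta> / h) ^ DIM('a) * measure lebesgue D" .
qed

text \<open>The field interpolates, by a cut-off \<open>\<eta>\<close> depending on
  \<open>\<nu> \<bullet> x\<close> alone, between \<open>\<phi>\<close> and the rotating unit field
  \<open>\<psi>\<close>. As \<open>\<omega>\<close> varies only along \<open>f\<close>, which is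
  orthogonal to \<open>\<nu>\<close>, the divergence of \<open>\<psi>\<close> is
  \<open>a cos \<omega>\<close>; the gradient of \<open>\<eta>\<close> contributes the last term.
  The norm stays at most 1 by convexity.\<close>

lemma glued_field:
  fixes K :: "'a::euclidean_space set" and \<phi> :: "'a \<Rightarrow> 'a" and a c s \<delta> :: real
  assumes K: "compact K" and nf: "norm \<nu> = 1" "norm f = 1" "\<nu> \<bullet> f = 0"
    and \<phi>: "test_field \<phi>" and d: "\<delta> > 0"
  defines "\<eta> \<equiv> \<lambda>x. smoothstep (1 + (\<nu> \<bullet> x - c) / \<delta>)" and "\<eta>' \<equiv> \<lambda>x. smoothstep' (1 + (\<nu> \<bullet> x - c) / \<delta>) / \<delta>"
    and "\<omega> \<equiv> \<lambda>x. a * (f \<bullet> x - s)"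
  obtains \<Phi> where "test_field \<Phi>"
    "\<And>x. x \<in> K \<Longrightarrow> divergence \<Phi> x = (1 - \<eta> x) * divergence \<phi> x + \<eta> x * (a * cos (\<omega> x)) + \<eta>' x * (cos (\<omega> x) - \<nu> \<bullet> \<phi> x)"
proof -
  have c1: "c1_field \<phi>" and n1: "\<And>x. norm (\<phi> x) \<le> 1" and b\<phi>: "bounded {x. \<phi> x \<noteq> 0}"
    using \<phi> by (auto simp: test_field_iff)
  obtain R where R: "\<And>x. x \<in> K \<Longrightarrow> norm x \<le> R" using compact_imp_bounded[OF K] by (auto simp: bounded_iff)
  \<comment> \<open>\<open>\<beta>\<close> equals 1 on \<open>K\<close>; it only makes the support of \<open>\<Phi>\<close> bounded\<close>
  define \<beta> where "\<beta> x = 1 - smoothstep (x \<bullet> x - R\<^sup>2)" for x :: 'a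
  define \<beta>' where "\<beta>' x = (- smoothstep' (x \<bullet> x - R\<^sup>2)) *\<^sub>R (2 *\<^sub>R x)" for x :: 'a
  define \<psi> where "\<psi> x = cos (\<omega> x) *\<^sub>R \<nu> + sin (\<omega> x) *\<^sub>R f" for x
  have g\<beta>: "c1_grad \<beta> \<beta>'" unfolding \<beta>_def[abs_def] \<beta>'_def[abs_def]
    by (rule c1_grad_compose[OF c1_grad_square])
       (auto intro!: derivative_eq_intros continuous_intros DERIV_chain2[OF smoothstep_deriv])
  have d\<eta>: "((\<lambda>t. smoothstep (1 + (t - c) / \<delta>)) has_real_derivative smoothstep' (1 + (t - c) / \<delta>) / \<delta>) (at t)" for t
  proof -
    have "((\<lambda>t. 1 + (t - c) / \<delta>) has_real_derivative 1 / \<delta>) (at t)"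
      using d by (auto intro!: derivative_eq_intros)
    from DERIV_chain2[OF smoothstep_deriv this] show ?thesis by simp
  qed
  have g\<eta>: "c1_grad \<eta> (\<lambda>x. \<eta>' x *\<^sub>R \<nu>)" unfolding \<eta>_def \<eta>'_def
    by (rule c1_grad_compose[OF c1_grad_linear, where F="\<lambda>t. smoothstep (1 + (t - c) / \<delta>)"
          and F'="\<lambda>t. smoothstep' (1 + (t - c) / \<delta>) / \<delta>"])
       (use d in \<open>auto intro!: continuous_intros d\<eta>\<close>)
  have g\<eta>1: "c1_grad (\<lambda>x. 1 - \<eta> x) (\<lambda>x. (- \<eta>' x) *\<^sub>R \<nu>)" unfolding \<eta>_def \<eta>'_def
    by (rule c1_grad_compose[OF c1_grad_linear, where F="\<lambda>t. 1 - smoothstep (1 + (t - c) / \<delta>)"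
          and F'="\<lambda>t. - (smoothstep' (1 + (t - c) / \<delta>) / \<delta>)"])
       (use d in \<open>auto intro!: derivative_eq_intros continuous_intros d\<eta>\<close>)
  have gc: "c1_grad (\<lambda>x. cos (\<omega> x)) (\<lambda>x. (- a * sin (\<omega> x)) *\<^sub>R f)" unfolding \<omega>_def
    by (rule c1_grad_compose[OF c1_grad_linear, where F="\<lambda>t. cos (a * (t - s))"
          and F'="\<lambda>t. - a * sin (a * (t - s))"])
       (auto intro!: derivative_eq_intros continuous_intros)
  have gs: "c1_grad (\<lambda>x. sin (\<omega> x)) (\<lambda>x. (a * cos (\<omega> x)) *\<^sub>R f)" unfolding \<omega>_def
    by (rule c1_grad_compose[OF c1_grad_linear, where F="\<lambda>t. sin (a * (t - s))"
          and F'="\<lambda>t. a * cos (a * (t - s))"])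
       (auto intro!: derivative_eq_intros continuous_intros)
  note psi1 = c1_field_scale[OF c1_field_const(1) gc, of \<nu>]
  note psi2 = c1_field_scale[OF c1_field_const(1) gs, of f]
  have ff: "f \<bullet> f = 1" "\<nu> \<bullet> \<nu> = 1" "f \<bullet> \<nu> = 0" using nf by (simp_all add: norm_eq_1 inner_commute)
  have psi: "c1_field \<psi>" "divergence \<psi> x = a * cos (\<omega> x)" for x
    using c1_field_add[OF psi1(1) psi2(1)] psi1(2) psi2(2) ff
    unfolding \<psi>_def[abs_def] by (simp_all add: c1_field_const(2))
  have "norm (\<psi> x) ^ 2 = 1" for x
    unfolding power2_norm_eq_inner \<psi>_def
    using ff by (simp add: inner_add_left inner_add_right nf(3) flip: power2_eq_square)
  then have npsi: "norm (\<psi> x) = 1" for x by (simp add: power2_eq_1_iff norm_ge_zero order.antisym)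
       (smt (verit) norm_ge_zero power2_eq_1_iff)
  define \<Phi> where "\<Phi> x = (1 - \<eta> x) *\<^sub>R \<phi> x + (\<eta> x * \<beta> x) *\<^sub>R \<psi> x" for x
  note chi1 = c1_field_scale[OF c1 g\<eta>1]
  note chi2 = c1_field_scale[OF psi(1) c1_grad_mult[OF g\<eta> g\<beta>]]
  have chi: "c1_field \<Phi>" "\<And>x. divergence \<Phi> x = (1 - \<eta> x) * divergence \<phi> x + (- \<eta>' x) *\<^sub>R \<nu> \<bullet> \<phi> x +
     (\<eta> x * \<beta> x * (a * cos (\<omega> x)) + (\<eta> x *\<^sub>R \<beta>' x + \<beta> x *\<^sub>R \<eta>' x *\<^sub>R \<nu>) \<bullet> \<psi> x)"
    using c1_field_add[OF chi1(1) chi2(1)] chi1(2) chi2(2) psi(2)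
    unfolding \<Phi>_def[abs_def] by simp_all
  have "test_field \<Phi>"
    unfolding test_field_iff
  proof (intro conjI allI)
    show "c1_field \<Phi>" by (rule chi)
    have "{x. \<Phi> x \<noteq> 0} \<subseteq> {x. \<phi> x \<noteq> 0} \<union> cball 0 (sqrt (R\<^sup>2 + 1))"
    proof
      fix x assume x: "x \<in> {x. \<Phi> x \<noteq> 0}"
      have "x \<bullet> x \<le> R\<^sup>2 + 1" if "\<phi> x = 0"
      proof (rule ccontr)
        assume "\<not> x \<bullet> x \<le> R\<^sup>2 + 1"
        then have "\<beta> x = 0" by (simp add: \<beta>_def smoothstep_high)
        then show False using x that by (simp add: \<Phi>_def)
      qed
      then show "x \<in> {x. \<phi> x \<noteq> 0} \<union> cball 0 (sqrt (R\<^sup>2 + 1))"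
        by (auto simp: norm_eq_sqrt_inner)
    qed
    then show "bounded {x. \<Phi> x \<noteq> 0}"
      using bounded_subset bounded_Un b\<phi> bounded_cball by metis
    fix x
    have \<eta>x: "0 \<le> \<eta> x" "\<eta> x \<le> 1" unfolding \<eta>_def by (rule smoothstep_range)+
    have \<beta>x: "0 \<le> \<beta> x" "\<beta> x \<le> 1" unfolding \<beta>_def using smoothstep_range[of "x \<bullet> x - R\<^sup>2"] by auto
    have "norm (\<Phi> x) \<le> \<bar>1 - \<eta> x\<bar> * norm (\<phi> x) + \<bar>\<eta> x * \<beta> x\<bar> * norm (\<psi> x)"
      unfolding \<Phi>_def by (rule order_trans[OF norm_triangle_ineq]) simp
    also have "\<dots> \<le> \<bar>1 - \<eta> x\<bar> * 1 + \<bar>\<eta> x\<bar> * 1"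
      using n1 npsi \<eta>x \<beta>x by (intro add_mono mult_mono) (auto simp: abs_mult mult_left_le)
    finally show "norm (\<Phi> x) \<le> 1" using \<eta>x by simp
  qed
  moreover have "divergence \<Phi> x = (1 - \<eta> x) * divergence \<phi> x + \<eta> x * (a * cos (\<omega> x)) + \<eta>' x * (cos (\<omega> x) - \<nu> \<bullet> \<phi> x)"
    if "x \<in> K" for x
  proof -
    have "x \<bullet> x \<le> R\<^sup>2" using power_mono[OF R[OF that], of 2] by (simp add: power2_norm_eq_inner)
    then have "\<beta> x = 1" "\<beta>' x = 0"
      by (simp_all add: \<beta>_def \<beta>'_def smoothstep_low smoothstep'_low)
    moreover have "\<nu> \<bullet> \<psi> x = cos (\<omega> x)" using ff nf by (simp add: \<psi>_def inner_add_right)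
    ultimately show ?thesis unfolding chi(2) by (simp add: algebra_simps)
  qed
  ultimately show thesis by (rule that)
qed

subsection \<open>Cutting a convex body by a half-space\<close>

lemma has_integral_indicator_subset:
  fixes b :: real
  assumes "D \<in> lmeasurable" "D \<subseteq> K"
  shows "((\<lambda>x. indicator D x * b) has_integral measure lebesgue D * b) K"
proof -
  have "((\<lambda>x. 1::real) has_integral measure lebesgue D) D"
    using assms(1) integrable_on_const lmeasure_integral by (metis has_integral_integral)
  then have "((\<lambda>x. if x \<in> D then 1 else 0) has_integral measure lebesgue D) K"
    by (simp add: has_integral_restrict[OF assms(2)])
  then have "(indicator D has_integral measure lebesgue D) K"
    by (simp add: indicator_def[abs_def] of_bool_def)
  then show ?thesis by (rule has_integral_mult_left)
qed

text \<open>The glued field is tested on \<open>K\<close>. In the cap its divergence is at least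
  \<open>a / 2\<close>; below the layer of thickness \<open>\<delta>\<close> it is that of
  \<open>\<phi>\<close>; in the layer it falls short by at most
  \<open>S + 4 * \<theta>\<^sup>2 / \<delta>\<close>. The volume of the layer is controlled by
  \<open>cap_layer\<close>.\<close>

lemma cap_gain_layer:
  fixes K :: "'a::euclidean_space set"
  assumes body: "convex_body K" and nf: "norm \<nu> = 1" "norm f = 1" "\<nu> \<bullet> f = 0"
    and p: "p \<in> K" "\<nu> \<bullet> p \<ge> c + h" and h: "h > 0" and d: "\<delta> > 0" "\<delta> \<le> h / 2"
    and \<theta>: "0 < \<theta>" "\<theta> \<le> 1/2" and r: "r > 0"
    and strip: "\<And>x. x \<in> K \<Longrightarrow> c < \<nu> \<bullet> x \<Longrightarrow> \<bar>f \<bullet> x - s\<bar> \<le> r"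
    and \<phi>: "test_field \<phi>" and S: "\<And>x. x \<in> K \<Longrightarrow> \<bar>divergence \<phi> x\<bar> \<le> S"
  defines "D \<equiv> K \<inter> {x. c < \<nu> \<bullet> x}"
  shows "integral (K \<inter> {x. \<nu> \<bullet> x \<le> c}) (divergence \<phi>) + \<theta> / (2 * r) * measure lebesgue D
     - (S + 4 * \<theta>\<^sup>2 / \<delta>) * (((1 + \<delta> / h) ^ DIM('a) - 1) * measure lebesgue D) \<le> perimeter K"
proof -
  have K: "compact K" "convex K" using body by (auto simp: convex_body_def)
  define D' where "D' = K \<inter> {x. c - \<delta> < \<nu> \<bullet> x}"
  define L where "L = D' - D"
  \<comment> \<open>This speed makes the angle run from at most \<open>\<theta>\<close> on one side
    of the strip to at most \<open>\<theta>\<close> on the other.\<close>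
  define a where "a = \<theta> / r"
  define q where "q = h / (h + \<delta>)"
  define \<omega> where "\<omega> x = a * (f \<bullet> x - s)" for x
  define t where "t x = 1 + (\<nu> \<bullet> x - c) / \<delta>" for x
  obtain \<Phi> where \<Phi>: "test_field \<Phi>"
    "\<And>x. x \<in> K \<Longrightarrow> divergence \<Phi> x = (1 - smoothstep (t x)) * divergence \<phi> x
      + smoothstep (t x) * (a * cos (\<omega> x)) + smoothstep' (t x) / \<delta> * (cos (\<omega> x) - \<nu> \<bullet> \<phi> x)"
    using glued_field[OF K(1) nf \<phi> d(1), where a=a and c=c and s=s] unfolding t_def \<omega>_def by blast
  have a: "a > 0" using \<theta> r by (simp add: a_def)
  have DD': "D \<subseteq> D'" using d by (auto simp: D_def D'_def)
  have Dm: "D \<in> lmeasurable" "D' \<in> lmeasurable" unfolding D_def D'_def by (rule measurable_cap[OF K])+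
  then have Lm: "L \<in> lmeasurable" unfolding L_def by (intro fmeasurable_Diff fmeasurableD)
  have mL: "measure lebesgue L = measure lebesgue D' - measure lebesgue D"
    unfolding L_def by (rule measurable_measure_Diff[OF Dm(2) fmeasurableD[OF Dm(1)] DD'])
  have sub: "D \<subseteq> K" "L \<subseteq> K" by (auto simp: D_def D'_def L_def)
  let ?K' = "K \<inter> {x. \<nu> \<bullet> x \<le> c}"
  have K': "compact ?K'" using K(1) by (intro compact_Int_closed closed_halfspace_le)
  have c1: "c1_field \<phi>" and n1: "\<And>x. norm (\<phi> x) \<le> 1" using \<phi> by (auto simp: test_field_iff)
  have \<nu>\<phi>: "\<nu> \<bullet> \<phi> x \<le> 1" for x
    using norm_cauchy_schwarz[of \<nu> "\<phi> x"] nf n1[of x] by simp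
  have q: "2/3 \<le> q" "q < 1" using h d by (auto simp: q_def field_simps)
  have \<omega>D: "\<bar>\<omega> x\<bar> \<le> \<theta>" if "x \<in> D" for x
  proof -
    have "\<bar>\<omega> x\<bar> \<le> a * r" unfolding \<omega>_def abs_mult using a strip that
      by (intro mult_mono) (auto simp: D_def)
    then show ?thesis using r by (simp add: a_def)
  qed
  \<comment> \<open>The strip condition is known only in \<open>D\<close>. Since
    \<open>\<omega>\<close> is affine and both \<open>p\<close> and the contracted point lie in
    \<open>D\<close>, extrapolation gives the factor \<open>(2 - q) / q\<close>, which is at most 2
    because \<open>q \<ge> 2/3\<close>.\<close>
  have \<omega>L: "\<bar>\<omega> x\<bar> \<le> 2 * \<theta>" if "x \<in> D'" for x
  proof -
    let ?y = "q *\<^sub>R x + (1 - q) *\<^sub>R p"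
    have "?y \<in> D" unfolding D_def q_def using cap_layer(1)[OF K p h d(1), of x] that by (simp add: D'_def)
    then have y: "\<bar>\<omega> ?y\<bar> \<le> \<theta>" by (rule \<omega>D)
    have "p \<in> D" using p h by (simp add: D_def)
    then have pp: "\<bar>\<omega> p\<bar> \<le> \<theta>" by (rule \<omega>D)
    have "\<omega> ?y = q * \<omega> x + (1 - q) * \<omega> p" by (simp add: \<omega>_def inner_add_right algebra_simps)
    then have "q * \<bar>\<omega> x\<bar> = \<bar>\<omega> ?y - (1 - q) * \<omega> p\<bar>" using q by (simp add: abs_mult)
    also have "\<dots> \<le> \<bar>\<omega> ?y\<bar> + (1 - q) * \<bar>\<omega> p\<bar>" using q by (metis abs_mult abs_of_pos abs_triangle_ineq4 diff_gt_0_iff_gt)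
    also have "\<dots> \<le> \<theta> + (1 - q) * \<theta>" using y pp q by (intro add_mono mult_left_mono) auto
    also have "\<dots> \<le> q * (2 * \<theta>)" using mult_right_mono[OF q(1), of "3 * \<theta>"] \<theta> by (simp add: algebra_simps)
    finally show ?thesis using q by simp
  qed
  have cos_ge: "1 - (2 * \<theta>)\<^sup>2 / 2 \<le> cos (\<omega> x)" if "x \<in> D'" for x
  proof -
    have "(\<omega> x)\<^sup>2 \<le> (2 * \<theta>)\<^sup>2" using power_mono[OF \<omega>L[OF that], of 2] by simp
    then show ?thesis using one_minus_cos_le[of "\<omega> x"] by simp
  qed
  have \<theta>2: "\<theta>\<^sup>2 \<le> 1/4" using power_mono[OF \<theta>(2), of 2] \<theta>(1) by (simp add: power2_eq_square)
  let ?u = "\<lambda>x. (if x \<in> ?K' then divergence \<phi> x else 0) + indicator D x * (a / 2)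
     - indicator L x * (S + 4 * \<theta>\<^sup>2 / \<delta>)"
  have bound: "?u x \<le> divergence \<Phi> x" if x: "x \<in> K" for x
  proof (cases "c < \<nu> \<bullet> x")
    case True
    then have xD: "x \<in> D" using x by (simp add: D_def)
    have "t x \<ge> 1" using True d by (simp add: t_def)
    then have div: "divergence \<Phi> x = a * cos (\<omega> x)"
      using \<Phi>(2)[OF x] by (simp add: smoothstep_high smoothstep'_high)
    have "1/2 \<le> cos (\<omega> x)" using cos_ge xD DD' \<theta>2 by (force simp: power_mult_distrib)
    then have "a * (1/2) \<le> a * cos (\<omega> x)" using a by (intro mult_left_mono) auto
    then show ?thesis using True xD div by (simp add: L_def)
  next
    case le: False
    then have xD: "x \<notin> D" "x \<in> ?K'" using x by (auto simp: D_def)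
    show ?thesis
    proof (cases "c - \<delta> < \<nu> \<bullet> x")
      case True
      then have xL: "x \<in> L" "x \<in> D'" using x xD by (auto simp: D'_def L_def)
      let ?e = "smoothstep (t x)" and ?e' = "smoothstep' (t x)"
      have e: "0 \<le> ?e" "?e \<le> 1" by (rule smoothstep_range)+
      have e': "0 \<le> ?e'" "?e' \<le> 2" by (rule smoothstep'_nonneg smoothstep'_le)+
      have c0: "0 \<le> cos (\<omega> x)" using cos_ge[OF xL(2)] \<theta>2 by (simp add: power_mult_distrib)
      have "?e * divergence \<phi> x \<le> \<bar>?e\<bar> * \<bar>divergence \<phi> x\<bar>" by (simp flip: abs_mult)
      also have "\<dots> \<le> 1 * S" using e S[OF x] by (intro mult_mono) auto
      finally have i1: "?e * divergence \<phi> x \<le> S" by simp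
      have i2: "0 \<le> ?e * (a * cos (\<omega> x))" using e a c0 by simp
      \<comment> \<open>The slope of the cut-off is as large as \<open>2 / \<delta>\<close>, but it
        multiplies a quantity that is negative by at most \<open>2 * \<theta>\<^sup>2\<close>: the
        normal part of \<open>\<phi>\<close> never exceeds 1 and that of the rotating field is
        nearly 1.\<close>
      have "- (2 * \<theta>\<^sup>2) \<le> cos (\<omega> x) - \<nu> \<bullet> \<phi> x"
        using cos_ge[OF xL(2)] \<nu>\<phi>[of x] by (simp add: power_mult_distrib)
      then have "?e' / \<delta> * (- (2 * \<theta>\<^sup>2)) \<le> ?e' / \<delta> * (cos (\<omega> x) - \<nu> \<bullet> \<phi> x)"
        using e' d by (intro mult_left_mono) auto
      moreover have "?e' / \<delta> * (2 * \<theta>\<^sup>2) \<le> 2 / \<delta> * (2 * \<theta>\<^sup>2)"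
        using e' d by (intro mult_right_mono divide_right_mono) auto
      ultimately have i3: "- (4 * \<theta>\<^sup>2 / \<delta>) \<le> ?e' / \<delta> * (cos (\<omega> x) - \<nu> \<bullet> \<phi> x)" by simp
      show ?thesis unfolding \<Phi>(2)[OF x] using xD xL i1 i2 i3 by (simp add: algebra_simps)
    next
      case False
      then have "t x \<le> 0" using d by (simp add: t_def field_simps)
      moreover have "x \<notin> L" using False by (simp add: L_def D'_def)
      ultimately show ?thesis unfolding \<Phi>(2)[OF x] using xD by (simp add: smoothstep_low smoothstep'_low)
    qed
  qed
  have "(divergence \<phi> has_integral integral ?K' (divergence \<phi>)) ?K'"
    using integrable_continuous_compact(1)[OF K' continuous_on_divergence[OF c1]] by (rule integrable_integral)
  then have "((\<lambda>x. if x \<in> ?K' then divergence \<phi> x else 0) has_integral integral ?K' (divergence \<phi>)) K"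
    using has_integral_restrict[of ?K' K] by blast
  then have hu: "(?u has_integral integral ?K' (divergence \<phi>) + measure lebesgue D * (a / 2)
     - measure lebesgue L * (S + 4 * \<theta>\<^sup>2 / \<delta>)) K"
    by (intro has_integral_diff has_integral_add has_integral_indicator_subset Dm Lm sub)
  have "(divergence \<Phi> has_integral integral K (divergence \<Phi>)) K"
    using integrable_continuous_compact(1)[OF K(1) continuous_on_divergence] \<Phi>(1)
    by (intro integrable_integral) (auto simp: test_field_iff)
  then have "integral ?K' (divergence \<phi>) + measure lebesgue D * (a / 2)
     - measure lebesgue L * (S + 4 * \<theta>\<^sup>2 / \<delta>) \<le> integral K (divergence \<Phi>)"
    by (rule has_integral_le[OF hu _ bound])
  also have "\<dots> \<le> perimeter K" by (rule perimeter_upper[OF body \<Phi>(1)])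
  finally have main: "integral ?K' (divergence \<phi>) + measure lebesgue D * (a / 2)
     - measure lebesgue L * (S + 4 * \<theta>\<^sup>2 / \<delta>) \<le> perimeter K" .
  have "measure lebesgue D' \<le> (1 + \<delta> / h) ^ DIM('a) * measure lebesgue D"
    unfolding D_def D'_def by (rule cap_layer(2)[OF K p h d(1)])
  then have "measure lebesgue L \<le> ((1 + \<delta> / h) ^ DIM('a) - 1) * measure lebesgue D"
    unfolding mL by (simp add: algebra_simps)
  moreover have "0 \<le> S + 4 * \<theta>\<^sup>2 / \<delta>" using S[OF p(1)] d by (intro add_nonneg_nonneg) auto
  ultimately have "measure lebesgue L * (S + 4 * \<theta>\<^sup>2 / \<delta>)
    \<le> (((1 + \<delta> / h) ^ DIM('a) - 1) * measure lebesgue D) * (S + 4 * \<theta>\<^sup>2 / \<delta>)"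
    by (rule mult_right_mono)
  moreover have "\<theta> / (2 * r) * measure lebesgue D = measure lebesgue D * (a / 2)" by (simp add: a_def mult.commute)
  ultimately show ?thesis using main by (simp only: mult.commute[of _ "S + 4 * \<theta>\<^sup>2 / \<delta>"])
qed

text \<open>Let \<open>\<delta>\<close> tend to 0. The volume of the layer is of order
  \<open>\<delta>\<close>, so the bound \<open>S\<close>, which depends on \<open>\<phi>\<close>,
  disappears, while \<open>4 * \<theta>\<^sup>2 / \<delta>\<close> leaves the term with
  \<open>DIM('a) / h\<close>.\<close>

lemma cap_gain:
  fixes K :: "'a::euclidean_space set"
  assumes body: "convex_body K" and nf: "norm \<nu> = 1" "norm f = 1" "\<nu> \<bullet> f = 0"
    and p: "p \<in> K" "\<nu> \<bullet> p \<ge> c + h" and h: "h > 0"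
    and \<theta>: "0 < \<theta>" "\<theta> \<le> 1/2" and r: "r > 0"
    and strip: "\<And>x. x \<in> K \<Longrightarrow> c < \<nu> \<bullet> x \<Longrightarrow> \<bar>f \<bullet> x - s\<bar> \<le> r"
  shows "perimeter (K \<inter> {x. \<nu> \<bullet> x \<le> c})
      + \<theta> * (1 / (2 * r) - 4 * \<theta> * (real DIM('a) / h)) * measure lebesgue (K \<inter> {x. c < \<nu> \<bullet> x}) \<le> perimeter K"
proof -
  let ?D = "K \<inter> {x. c < \<nu> \<bullet> x}" and ?K' = "K \<inter> {x. \<nu> \<bullet> x \<le> c}"
  let ?G = "\<theta> * (1 / (2 * r) - 4 * \<theta> * (real DIM('a) / h)) * measure lebesgue ?D"
  have "perimeter ?K' \<le> perimeter K - ?G"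
  proof (rule perimeter_least)
    fix \<phi> :: "'a \<Rightarrow> 'a" assume \<phi>: "test_field \<phi>"
    have "compact K" using body by (simp add: convex_body_def)
    then have "bounded (divergence \<phi> ` K)"
      using \<phi> by (intro compact_imp_bounded compact_continuous_image continuous_on_divergence)
        (simp_all add: test_field_iff)
    then obtain S where S: "\<And>x. x \<in> K \<Longrightarrow> \<bar>divergence \<phi> x\<bar> \<le> S"
      by (auto simp: bounded_iff)
    let ?Q = "\<lambda>\<delta>. ((1 + \<delta> / h) ^ DIM('a) - 1) / \<delta>"
    let ?F = "\<lambda>\<delta>. integral ?K' (divergence \<phi>) + \<theta> / (2 * r) * measure lebesgue ?D
       - (S * \<delta> + 4 * \<theta>\<^sup>2) * (?Q \<delta> * measure lebesgue ?D)"
    have l1: "(?Q \<longlongrightarrow> real DIM('a) / h) (at_right 0)"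
      by (rule tendsto_mono[OF at_le[OF subset_UNIV] power_quotient_tendsto]) (use h in simp)
    have l2: "((\<lambda>\<delta>. S * \<delta> + 4 * \<theta>\<^sup>2) \<longlongrightarrow> S * 0 + 4 * \<theta>\<^sup>2) (at_right 0)"
      by (intro tendsto_intros)
    have lim: "(?F \<longlongrightarrow> integral ?K' (divergence \<phi>) + \<theta> / (2 * r) * measure lebesgue ?D
       - (S * 0 + 4 * \<theta>\<^sup>2) * (real DIM('a) / h * measure lebesgue ?D)) (at_right 0)"
      by (intro tendsto_diff tendsto_mult tendsto_const l1 l2)
    have "\<forall>\<^sub>F \<delta> in at_right 0. ?F \<delta> \<le> perimeter K"
      unfolding eventually_at_right_field
    proof (intro exI[of _ "h / 2"] conjI allI impI)
      show "0 < h / 2" using h by simp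
      fix \<delta> assume d: "0 < \<delta>" "\<delta> < h / 2"
      have "(S * \<delta> + 4 * \<theta>\<^sup>2) * (?Q \<delta> * measure lebesgue ?D)
         = (S + 4 * \<theta>\<^sup>2 / \<delta>) * (((1 + \<delta> / h) ^ DIM('a) - 1) * measure lebesgue ?D)"
        using d by (simp add: field_simps)
      then show "?F \<delta> \<le> perimeter K"
        using cap_gain_layer[OF body nf p h d(1) less_imp_le[OF d(2)] \<theta> r strip \<phi> S] by simp
    qed
    from tendsto_upperbound[OF lim this]
    show "integral ?K' (divergence \<phi>) \<le> perimeter K - ?G"
      by (simp add: algebra_simps power2_eq_square)
  qed
  then show ?thesis by simp
qed

text \<open>The truncated body is an admissible competitor. Dividing the perimeter gain by the
  volume of the cap leaves an inequality in \<open>\<theta>\<close> alone, which is then optimised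
  up to constants.\<close>

lemma qmpcc_cap:
  fixes K :: "'a::euclidean_space set"
  assumes qm: "qmpcc \<Lambda> \<epsilon> K" "\<Lambda> > 0" and nf: "norm \<nu> = 1" "norm f = 1" "\<nu> \<bullet> f = 0"
    and p: "p \<in> K" "\<nu> \<bullet> p \<ge> c + h" and h: "h > 0" and r: "r > 0" "8 * \<Lambda> * r < 1"
    and strip: "\<And>x. x \<in> K \<Longrightarrow> c < \<nu> \<bullet> x \<Longrightarrow> \<bar>f \<bullet> x - s\<bar> \<le> r"
    and small: "measure lebesgue (K \<inter> {x. c < \<nu> \<bullet> x}) \<le> \<epsilon>"
    and rest: "interior (K \<inter> {x. \<nu> \<bullet> x \<le> c}) \<noteq> {}"
  shows "h \<le> 64 * real DIM('a) * \<Lambda> * r\<^sup>2"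
proof -
  let ?D = "K \<inter> {x. c < \<nu> \<bullet> x}" and ?K' = "K \<inter> {x. \<nu> \<bullet> x \<le> c}" and ?N = "real DIM('a)"
  have body: "convex_body K" using qm by (simp add: qmpcc_def)
  then have K: "compact K" "convex K" "interior K \<noteq> {}" by (auto simp: convex_body_def)
  have body': "convex_body ?K'"
    using K rest by (auto simp: convex_body_def intro!: compact_Int_closed closed_halfspace_le convex_Int convex_halfspace_le)
  have D_eq: "K - ?K' = ?D" by auto
  have le: "perimeter K \<le> perimeter ?K' + \<Lambda> * measure lebesgue ?D"
    using qm body' small unfolding qmpcc_def by (metis D_eq Int_lower1)
  \<comment> \<open>Positive volume is needed for the division: \<open>p\<close> is a limit of
    interior points of \<open>K\<close> and lies in the open half-space.\<close>
  have "measure lebesgue ?D \<noteq> 0"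
  proof
    assume "measure lebesgue ?D = 0"
    then have "negligible ?D" using measurable_cap[OF K(1,2)] by (simp add: negligible_iff_measure)
    then have neg: "negligible (interior K \<inter> {x. c < \<nu> \<bullet> x})"
      by (rule negligible_subset) (use interior_subset in blast)
    have "p \<in> closure (interior K)"
      using p(1) convex_closure_interior[OF K(2,3)] closure_subset by blast
    moreover have "p \<in> {x. c < \<nu> \<bullet> x}" using p(2) h by simp
    ultimately have "interior K \<inter> {x. c < \<nu> \<bullet> x} \<noteq> {}"
      using open_Int_closure_eq_empty[OF open_halfspace_gt[of c \<nu>], of "interior K"] by blast
    then show False using neg open_not_negligible open_Int open_interior open_halfspace_gt by metis
  qed
  then have Dpos: "measure lebesgue ?D > 0" by (simp add: zero_less_measure_iff)
  have key: "\<theta> * (1 / (2 * r) - 4 * \<theta> * (?N / h)) \<le> \<Lambda>" if "0 < \<theta>" "\<theta> \<le> 1/2" for \<theta>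
  proof -
    have "\<theta> * (1 / (2 * r) - 4 * \<theta> * (?N / h)) * measure lebesgue ?D \<le> \<Lambda> * measure lebesgue ?D"
      using cap_gain[OF body nf p h that r(1) strip] le by simp
    then show ?thesis using Dpos by simp
  qed
  \<comment> \<open>The second entry makes the negative term at most half of
    \<open>1 / (2 * r)\<close>.\<close>
  define \<theta> where "\<theta> = min (1/2) (h / (16 * r * ?N))"
  have N: "?N > 0" by simp
  have t: "0 < \<theta>" "\<theta> \<le> 1/2" using h r N by (auto simp: \<theta>_def)
  have "4 * \<theta> * (?N / h) \<le> 4 * (h / (16 * r * ?N)) * (?N / h)"
    using h by (intro mult_right_mono) (auto simp: \<theta>_def)
  also have "\<dots> = 1 / (4 * r)" using h N r by (simp add: field_simps)
  finally have "\<theta> * (1 / (4 * r)) \<le> \<theta> * (1 / (2 * r) - 4 * \<theta> * (?N / h))"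
    using t by (intro mult_left_mono) auto
  also note key[OF t]
  finally have "\<theta> \<le> 4 * \<Lambda> * r" using r by (simp add: field_simps)
  \<comment> \<open>By \<open>8 * \<Lambda> * r < 1\<close> the value 1/2 is excluded, so the
    minimum is its second entry.\<close>
  moreover from this have "\<theta> = h / (16 * r * ?N)" using r by (auto simp: \<theta>_def min_def split: if_splits)
  ultimately show ?thesis using r N by (simp add: field_simps power2_eq_square)
qed

subsection \<open>Polar bodies\<close>

text \<open>The polar body of \<open>K - z\<close>. The gauge of \<open>K - z\<close> is its support
  function, so subgradients of the gauge at \<open>v\<close> are the elements that maximise
  \<open>\<xi> \<bullet> v\<close>.\<close>

definition polar :: "'a::euclidean_space \<Rightarrow> 'a set \<Rightarrow> 'a set" where
  "polar z K = {\<xi>. \<forall>y\<in>K. \<xi> \<bullet> (y - z) \<le> 1}"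

lemma polarD: "\<xi> \<in> polar z K \<Longrightarrow> y \<in> K \<Longrightarrow> \<xi> \<bullet> (y - z) \<le> 1"
  by (simp add: polar_def)

text \<open>Test \<open>\<xi>\<close> on the point of the closed inner ball that lies furthest in
  the direction of \<open>\<xi>\<close>.\<close>

lemma norm_polar_le:
  assumes "closed K" "ball z m \<subseteq> K" "m > 0" "\<xi> \<in> polar z K"
  shows "norm \<xi> \<le> 1 / m"
proof (cases "\<xi> = 0")
  case False
  have "z + (m / norm \<xi>) *\<^sub>R \<xi> \<in> cball z m" using False assms(3) by (simp add: dist_norm)
  then have "z + (m / norm \<xi>) *\<^sub>R \<xi> \<in> K" using cball_subset_closed[OF assms(1-3)] by blast
  from polarD[OF assms(4) this] have "m / norm \<xi> * (\<xi> \<bullet> \<xi>) \<le> 1" by simp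
  then have "m * norm \<xi> \<le> 1" using False by (simp add: power2_norm_eq_inner[symmetric] power2_eq_square)
  then show ?thesis using assms(3) by (simp add: field_simps)
qed (use assms(3) in simp)

lemma compact_polar:
  assumes "closed K" "ball z m \<subseteq> K" "m > 0"
  shows "compact (polar z K)"
proof -
  have "polar z K = (\<Inter>y\<in>K. {\<xi>. (y - z) \<bullet> \<xi> \<le> 1})"
    by (auto simp: polar_def inner_commute)
  then have "closed (polar z K)" by (auto simp: closed_halfspace_le)
  moreover have "bounded (polar z K)"
    using norm_polar_le[OF assms] by (auto simp: bounded_iff)
  ultimately show ?thesis by (simp add: compact_eq_bounded_closed)
qed

text \<open>A hyperplane strictly separating \<open>z + v\<close> from \<open>K\<close>, normalised
  by its gap \<open>\<beta>\<close> at \<open>z\<close>, yields a polar vector whose value at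
  \<open>v\<close> exceeds 1.\<close>

lemma bipolar:
  assumes K: "closed K" "convex K" "z \<in> K" and v: "\<And>\<xi>. \<xi> \<in> polar z K \<Longrightarrow> \<xi> \<bullet> v \<le> 1"
  shows "z + v \<in> K"
proof (rule ccontr)
  assume "z + v \<notin> K"
  then obtain a b where ab: "a \<bullet> (z + v) < b" "\<And>x. x \<in> K \<Longrightarrow> b < a \<bullet> x"
    using separating_hyperplane_closed_point[OF K(2,1)] by blast
  define \<beta> where "\<beta> = a \<bullet> z - b"
  have b: "\<beta> > 0" using ab(2)[OF K(3)] by (simp add: \<beta>_def)
  have "(- a /\<^sub>R \<beta>) \<in> polar z K"
    unfolding polar_def
  proof (intro CollectI ballI)
    fix y assume "y \<in> K"
    then have "- (a \<bullet> (y - z)) \<le> \<beta>" using ab(2)[of y] by (simp add: \<beta>_def inner_diff_right)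
    then show "(- a /\<^sub>R \<beta>) \<bullet> (y - z) \<le> 1" using b by (simp add: field_simps)
  qed
  from v[OF this] have "- (a \<bullet> v) \<le> \<beta>" using b by (simp add: field_simps)
  then show False using ab(1) by (simp add: \<beta>_def inner_add_right)
qed

text \<open>The homothetic copy of \<open>K\<close> with ratio \<open>1 - \<tau>\<close> about
  \<open>z\<close> misses the cap, and Bernoulli's inequality bounds the volume that is
  left.\<close>

lemma measure_cap_le:
  fixes K :: "'a::euclidean_space set"
  assumes K: "compact K" "convex K" "z \<in> K" and \<zeta>: "\<zeta> \<in> polar z K" and \<tau>: "0 \<le> \<tau>" "\<tau> \<le> 1"
  shows "measure lebesgue (K \<inter> {x. 1 - \<tau> < \<zeta> \<bullet> (x - z)}) \<le> real DIM('a) * \<tau> * measure lebesgue K"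
proof -
  let ?D = "K \<inter> {x. 1 - \<tau> < \<zeta> \<bullet> (x - z)}"
  let ?T = "(\<lambda>x. (1 - \<tau>) *\<^sub>R x + \<tau> *\<^sub>R z) ` K"
  have T: "compact ?T" using K(1) by (intro compact_continuous_image continuous_intros)
  have TK: "?T \<subseteq> K" using convexD[OF K(2) _ K(3)] \<tau> by auto
  have "x \<notin> ?T" if "x \<in> ?D" for x
  proof
    assume "x \<in> ?T"
    then obtain k where k: "k \<in> K" "x = (1 - \<tau>) *\<^sub>R k + \<tau> *\<^sub>R z" by auto
    then have "x - z = (1 - \<tau>) *\<^sub>R (k - z)" by (simp add: algebra_simps)
    then have "\<zeta> \<bullet> (x - z) = (1 - \<tau>) * (\<zeta> \<bullet> (k - z))" by simp
    also have "\<dots> \<le> (1 - \<tau>) * 1" using \<tau> polarD[OF \<zeta> k(1)] by (intro mult_left_mono) auto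
    finally show False using that by simp
  qed
  then have sub: "?D \<subseteq> K - ?T" by blast
  have KT: "K - ?T \<in> lmeasurable" using K(1) T by (intro fmeasurable_Diff fmeasurableD lmeasurable_compact)
  have "{x. 1 - \<tau> < \<zeta> \<bullet> (x - z)} = {x. 1 - \<tau> + \<zeta> \<bullet> z < \<zeta> \<bullet> x}" by (auto simp: inner_diff_right)
  then have "?D \<in> lmeasurable" using measurable_cap[OF K(1,2)] by simp
  then have "measure lebesgue ?D \<le> measure lebesgue (K - ?T)"
    using sub KT by (intro measure_mono_fmeasurable) auto
  also have "\<dots> = measure lebesgue K - measure lebesgue ?T"
    using K(1) T by (intro measurable_measure_Diff fmeasurableD lmeasurable_compact TK)
  also have "measure lebesgue ?T = (1 - \<tau>) ^ DIM('a) * measure lebesgue K"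
    using measure_lebesgue_affine[of "1 - \<tau>" "\<tau> *\<^sub>R z" K] \<tau> by simp
  also have "measure lebesgue K - (1 - \<tau>) ^ DIM('a) * measure lebesgue K
      = (1 - (1 - \<tau>) ^ DIM('a)) * measure lebesgue K" by (simp add: algebra_simps)
  also have "\<dots> \<le> (real DIM('a) * \<tau>) * measure lebesgue K"
    using Bernoulli_inequality[of "- \<tau>" "DIM('a)"] \<tau> by (intro mult_right_mono) auto
  finally show ?thesis .
qed

section \<open>Lipschitz estimate for subgradients of the gauge\<close>

text \<open>Of \<open>\<xi>1\<close> only polarity and a comparison with \<open>\<xi>0\<close> at
  \<open>x1\<close> are asked. This comparison is invariant under positive scaling, so
  \<open>x1\<close> may be off the boundary. The constant \<open>C1\<close> is the ratio of the
  half-width of the strip to \<open>r\<close>; the conditions \<open>rs\<close> are the smallness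
  assumptions of \<open>qmpcc_cap\<close>.\<close>

lemma polar_gap:
  fixes K :: "'a::euclidean_space set"
  assumes qm: "qmpcc \<Lambda> \<epsilon> K" "\<Lambda> > 0" and m: "0 < m" "ball z m \<subseteq> K" and M: "K \<subseteq> ball z M" "0 < M"
    and \<xi>: "\<xi>0 \<in> polar z K" "\<xi>1 \<in> polar z K" and x0: "z + x0 \<in> K" "\<xi>0 \<bullet> x0 = 1"
    and x1: "\<xi>0 \<bullet> x1 \<le> \<xi>1 \<bullet> x1" and r: "norm (x0 - x1) \<le> r" "0 < r" "r \<le> m / 4"
  defines "C1 \<equiv> (2 + 4 * M / m) * ((4 * M + 2 * m) / m)"
  assumes rs: "8 * \<Lambda> * (C1 * r) < 1" "real DIM('a) * (2 * r / m) * measure lebesgue K \<le> \<epsilon>"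
  shows "norm (\<xi>1 - \<xi>0) \<le> 128 * real DIM('a) * \<Lambda> * C1\<^sup>2 / m * r"
proof (cases "\<xi>1 = \<xi>0")
  case True
  then show ?thesis using qm(2) m r by simp
next
  case False
  have body: "convex_body K" using qm by (simp add: qmpcc_def)
  then have K: "compact K" "convex K" "interior K \<noteq> {}" by (auto simp: convex_body_def)
  have cl: "closed K" using K(1) by (rule compact_imp_closed)
  have zK: "z \<in> K" using m by auto
  define lam where "lam = norm (\<xi>1 - \<xi>0)"
  define e where "e = (\<xi>1 - \<xi>0) /\<^sub>R lam"
  define \<tau> where "\<tau> = lam * r"
  define \<zeta> where "\<zeta> = (1/2) *\<^sub>R (\<xi>0 + \<xi>1)"
  define n where "n = norm \<zeta>"
  define \<nu> where "\<nu> = \<zeta> /\<^sub>R n"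
  have lam: "lam > 0" using False by (simp add: lam_def)
  have e: "norm e = 1" "\<xi>1 - \<xi>0 = lam *\<^sub>R e" using lam by (auto simp: e_def lam_def)
  have n01: "norm \<xi>0 \<le> 1 / m" "norm \<xi>1 \<le> 1 / m" using norm_polar_le[OF cl m(2,1)] \<xi> by auto
  have lam_le: "lam \<le> 2 / m"
    using norm_triangle_ineq4[of \<xi>1 \<xi>0] n01 by (simp add: lam_def)
  have \<tau>_le: "\<tau> \<le> 2 * r / m" using mult_right_mono[OF lam_le, of r] r by (simp add: \<tau>_def)
  have "2 * r / m \<le> 1/2" using r m by (simp add: field_simps)
  with \<tau>_le have "\<tau> \<le> 1/2" by (rule order_trans)
  moreover have "0 < \<tau>" using lam r by (simp add: \<tau>_def)
  ultimately have \<tau>: "0 < \<tau>" "\<tau> \<le> 1/2" by blast+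
  have \<zeta>K: "\<zeta> \<in> polar z K"
    unfolding polar_def
  proof (intro CollectI ballI)
    fix y assume "y \<in> K"
    then show "\<zeta> \<bullet> (y - z) \<le> 1"
      using polarD[OF \<xi>(1), of y] polarD[OF \<xi>(2), of y] by (simp add: \<zeta>_def inner_add_left)
  qed
  then have n_le: "n \<le> 1 / m" unfolding n_def using norm_polar_le[OF cl m(2,1)] by blast
  have x0M: "norm x0 \<le> M" using x0 M by (force simp: dist_norm)
  \<comment> \<open>Monotonicity of subgradients:
    \<open>(\<xi>0 - \<xi>1) \<bullet> (x0 - x1)\<close> is at least
    \<open>1 - \<xi>1 \<bullet> x0\<close>, and Cauchy-Schwarz bounds it by
    \<open>\<tau>\<close>.\<close>
  have \<xi>1x0: "1 - \<tau> \<le> \<xi>1 \<bullet> x0" "\<xi>1 \<bullet> x0 \<le> 1"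
  proof -
    have "(\<xi>0 - \<xi>1) \<bullet> (x0 - x1) \<le> norm (\<xi>0 - \<xi>1) * norm (x0 - x1)"
      by (rule norm_cauchy_schwarz)
    also have "\<dots> \<le> lam * r"
      unfolding lam_def norm_minus_commute[of \<xi>1] by (rule mult_left_mono[OF r(1) norm_ge_zero])
    finally show "1 - \<tau> \<le> \<xi>1 \<bullet> x0" using x0 x1 by (simp add: \<tau>_def inner_diff_left inner_diff_right)
    show "\<xi>1 \<bullet> x0 \<le> 1" using polarD[OF \<xi>(2) x0(1)] by simp
  qed
  have \<zeta>x0: "1 - \<tau> / 2 \<le> \<zeta> \<bullet> x0" using \<xi>1x0 x0 by (simp add: \<zeta>_def inner_add_left)
  have "1/2 \<le> n * M"
  proof -
    have "\<zeta> \<bullet> x0 \<le> n * norm x0" unfolding n_def by (rule norm_cauchy_schwarz)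
    also have "\<dots> \<le> n * M" using x0M by (intro mult_left_mono) (auto simp: n_def)
    finally show ?thesis using \<zeta>x0 \<tau> by simp
  qed
  note nM = this
  have "n \<noteq> 0" using nM by auto
  then have n: "n > 0" by (simp add: n_def)
  then have inv_n: "1 / n \<le> 2 * M" using nM by (simp add: field_simps)
  have \<nu>: "norm \<nu> = 1" using n by (simp add: \<nu>_def n_def)
  have \<nu>in: "\<nu> \<bullet> x = (\<zeta> \<bullet> x) / n" for x by (simp add: \<nu>_def field_simps)
  \<comment> \<open>\<open>e\<close> need not be orthogonal to \<open>\<nu>\<close>, but it is nearly orthogonal to \<open>x0\<close>, which keeps its
    component \<open>w\<close> orthogonal to \<open>\<nu>\<close> away from 0\<close>
  define a where "a = e \<bullet> \<nu>"
  define w where "w = e - a *\<^sub>R \<nu>"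
  define b where "b = norm w"
  define f where "f = w /\<^sub>R b"
  have ex0: "\<bar>e \<bullet> x0\<bar> \<le> r"
  proof -
    have "lam * (e \<bullet> x0) = \<xi>1 \<bullet> x0 - 1" using e(2) x0(2) by (metis inner_diff_left inner_scaleR_left)
    then have "\<bar>lam * (e \<bullet> x0)\<bar> \<le> lam * r" using \<xi>1x0 by (simp add: \<tau>_def)
    then show ?thesis using lam by (simp add: abs_mult)
  qed
  \<comment> \<open>If \<open>b\<close> were small, \<open>e\<close> would be almost parallel to
    \<open>\<nu>\<close>, and \<open>\<bar>e \<bullet> x0\<bar>\<close> would be close to
    \<open>\<nu> \<bullet> x0 \<ge> m / 2\<close>; but it is at most
    \<open>r \<le> m / 4\<close>.\<close>
  have b_ge: "m / (4 * M + 2 * m) \<le> b"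
  proof -
    have "norm e \<le> norm (a *\<^sub>R \<nu>) + norm w" using norm_triangle_ineq[of "a *\<^sub>R \<nu>" w] by (simp add: w_def)
    then have ab: "1 - b \<le> \<bar>a\<bar>" using e \<nu> by (simp add: b_def)
    have "m / 2 \<le> \<nu> \<bullet> x0"
    proof -
      have "1/2 \<le> \<zeta> \<bullet> x0" using \<zeta>x0 \<tau> by simp
      moreover have "m \<le> 1 / n" using n n_le m by (simp add: field_simps)
      ultimately have "(1/2) * m \<le> (\<zeta> \<bullet> x0) * (1 / n)" using m by (intro mult_mono) auto
      then show ?thesis by (simp add: \<nu>in)
    qed
    moreover have "a * (\<nu> \<bullet> x0) = e \<bullet> x0 - w \<bullet> x0" by (simp add: w_def inner_diff_left)
    then have "\<bar>a\<bar> * \<bar>\<nu> \<bullet> x0\<bar> \<le> \<bar>e \<bullet> x0\<bar> + \<bar>w \<bullet> x0\<bar>" by (metis abs_mult abs_triangle_ineq4)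
    moreover have "\<bar>w \<bullet> x0\<bar> \<le> b * M"
      using Cauchy_Schwarz_ineq2[of w x0] mult_left_mono[OF x0M, of b] by (simp add: b_def)
    moreover have "\<bar>a\<bar> * (m / 2) \<le> \<bar>a\<bar> * \<bar>\<nu> \<bullet> x0\<bar>" using calculation(1) by (intro mult_left_mono) auto
    moreover have "(1 - b) * (m / 2) \<le> \<bar>a\<bar> * (m / 2)" using ab m by (intro mult_right_mono) auto
    ultimately have "(1 - b) * (m / 2) \<le> m / 4 + b * M" using ex0 r(3) by linarith
    then have "m \<le> b * (4 * M + 2 * m)" by (simp add: algebra_simps)
    then show ?thesis using m M by (simp add: field_simps)
  qed
  have b: "b > 0" using b_ge m M by (smt (verit) divide_pos_pos mult_pos_pos)
  have inv_b: "1 / b \<le> (4 * M + 2 * m) / m" using b_ge b m M by (simp add: field_simps)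
  have f: "norm f = 1" using b by (simp add: f_def b_def)
  have "\<nu> \<bullet> \<nu> = 1" using \<nu> by (simp add: norm_eq_1)
  then have "\<nu> \<bullet> w = 0" by (simp add: w_def a_def inner_diff_right inner_commute)
  then have \<nu>f: "\<nu> \<bullet> f = 0" by (simp add: f_def)
  define c where "c = \<nu> \<bullet> z + (1 - \<tau>) / n"
  \<comment> \<open>The value of \<open>f \<bullet> x\<close> where
    \<open>e \<bullet> (x - z) = 0\<close> and \<open>\<nu> \<bullet> (x - z) = 1 / n\<close>; on
    the cap both equations hold up to order \<open>r\<close>.\<close>
  define s where "s = f \<bullet> z - a / (b * n)"
  have cut: "c < \<nu> \<bullet> x \<longleftrightarrow> 1 - \<tau> < \<zeta> \<bullet> (x - z)" for x
  proof -
    have "c < \<nu> \<bullet> x \<longleftrightarrow> (1 - \<tau>) / n < \<nu> \<bullet> (x - z)" by (auto simp: c_def inner_diff_right)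
    then show ?thesis using n by (simp add: \<nu>in divide_less_cancel)
  qed
  have strip: "\<bar>f \<bullet> x - s\<bar> \<le> C1 * r" if x: "x \<in> K" "c < \<nu> \<bullet> x" for x
  proof -
    let ?y = "x - z"
    have \<zeta>y: "1 - \<tau> < \<zeta> \<bullet> ?y" "\<zeta> \<bullet> ?y \<le> 1" using x cut polarD[OF \<zeta>K] by auto
    have y: "\<xi>0 \<bullet> ?y \<le> 1" "\<xi>1 \<bullet> ?y \<le> 1" using polarD \<xi> x by auto
    have "2 * (\<zeta> \<bullet> ?y) = \<xi>0 \<bullet> ?y + \<xi>1 \<bullet> ?y" by (simp add: \<zeta>_def inner_add_left)
    moreover have "lam * (e \<bullet> ?y) = \<xi>1 \<bullet> ?y - \<xi>0 \<bullet> ?y" using e(2) by (metis inner_diff_left inner_scaleR_left)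
    \<comment> \<open>Two numbers at most 1 with sum above \<open>2 - 2 * \<tau>\<close> differ by
      at most \<open>2 * \<tau>\<close>.\<close>
    ultimately have "\<bar>lam * (e \<bullet> ?y)\<bar> \<le> lam * (2 * r)" using y \<zeta>y by (simp add: \<tau>_def abs_le_iff)
    then have ey: "\<bar>e \<bullet> ?y\<bar> \<le> 2 * r" using lam by (simp add: abs_mult)
    have "\<bar>\<nu> \<bullet> ?y - 1 / n\<bar> = \<bar>\<zeta> \<bullet> ?y - 1\<bar> * (1 / n)" using n by (simp add: \<nu>in diff_divide_distrib[symmetric])
    also have "\<dots> \<le> (2 * r / m) * (2 * M)" using \<zeta>y \<tau>_le inv_n n r m by (intro mult_mono) auto
    finally have \<nu>y: "\<bar>\<nu> \<bullet> ?y - 1 / n\<bar> \<le> 4 * M / m * r" by (simp add: mult_ac)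
    have a1: "\<bar>a\<bar> \<le> 1" using Cauchy_Schwarz_ineq2[of e \<nu>] e \<nu> by (simp add: a_def)
    have "f \<bullet> x - s = f \<bullet> ?y + a / (b * n)" by (simp add: s_def inner_diff_right)
    also have "f \<bullet> ?y = (e \<bullet> ?y - a * (\<nu> \<bullet> ?y)) / b" by (simp add: f_def w_def inner_diff_left divide_inverse mult.commute)
    also have "\<dots> + a / (b * n) = (e \<bullet> ?y - a * (\<nu> \<bullet> ?y - 1 / n)) / b"
      using b n by (simp add: diff_divide_distrib right_diff_distrib)
    finally have "\<bar>f \<bullet> x - s\<bar> = \<bar>e \<bullet> ?y - a * (\<nu> \<bullet> ?y - 1 / n)\<bar> * (1 / b)" using b by (simp add: abs_mult)
    also have "\<dots> \<le> (2 * r + 4 * M / m * r) * ((4 * M + 2 * m) / m)"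
    proof (intro mult_mono inv_b)
      have "\<bar>a * (\<nu> \<bullet> ?y - 1 / n)\<bar> \<le> 1 * (4 * M / m * r)" unfolding abs_mult using a1 \<nu>y by (intro mult_mono) auto
      then show "\<bar>e \<bullet> ?y - a * (\<nu> \<bullet> ?y - 1 / n)\<bar> \<le> 2 * r + 4 * M / m * r" using ey by linarith
    qed (use b m M r in auto)
    also have "2 * r + 4 * M / m * r = (2 + 4 * M / m) * r" by (simp add: distrib_right)
    also have "\<dots> * ((4 * M + 2 * m) / m) = C1 * r" unfolding C1_def by (simp only: mult_ac)
    finally show ?thesis .
  qed
  have C1: "C1 > 0" unfolding C1_def using m M by (intro mult_pos_pos add_pos_pos divide_pos_pos) auto
  have "lam * r * m / 2 \<le> 64 * real DIM('a) * \<Lambda> * (C1 * r)\<^sup>2"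
  proof (rule qmpcc_cap[OF qm \<nu> f \<nu>f x0(1) _ _ _ rs(1) strip])
    \<comment> \<open>At \<open>x0\<close> the form \<open>\<zeta>\<close> exceeds the level of the
      cut by \<open>\<tau> / 2\<close> at least; normalising divides by
      \<open>n \<le> 1 / m\<close>.\<close>
    have "\<tau> / 2 * m \<le> \<tau> / 2 * (1 / n)" using n n_le m \<tau> by (intro mult_left_mono) (auto simp: field_simps)
    also have "\<dots> \<le> (\<zeta> \<bullet> x0 - (1 - \<tau>)) * (1 / n)" using \<zeta>x0 n by (intro mult_right_mono) auto
    also have "\<dots> = \<nu> \<bullet> (z + x0) - c" by (simp add: c_def inner_add_right \<nu>in diff_divide_distrib)
    finally show "c + lam * r * m / 2 \<le> \<nu> \<bullet> (z + x0)" by (simp add: \<tau>_def)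
    show "0 < lam * r * m / 2" using lam r m by simp
    show "0 < C1 * r" using C1 r by simp
    have "measure lebesgue (K \<inter> {x. 1 - \<tau> < \<zeta> \<bullet> (x - z)}) \<le> real DIM('a) * \<tau> * measure lebesgue K"
      using \<tau> by (intro measure_cap_le K zK \<zeta>K) auto
    also have "\<dots> \<le> real DIM('a) * (2 * r / m) * measure lebesgue K"
      using \<tau>_le by (intro mult_right_mono mult_left_mono) auto
    finally show "measure lebesgue (K \<inter> {x. c < \<nu> \<bullet> x}) \<le> \<epsilon>" unfolding cut using rs(2) by simp
    \<comment> \<open>On the half-size ball \<open>\<zeta>\<close> is at most 1/2, hence at most
      \<open>1 - \<tau>\<close>, so the cut leaves a body with interior.\<close>
    have "ball z (m / 2) \<subseteq> K \<inter> {x. \<nu> \<bullet> x \<le> c}"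
    proof
      fix x assume x: "x \<in> ball z (m / 2)"
      then have "x \<in> K" using m by (auto simp: subset_iff)
      moreover have "\<zeta> \<bullet> (x - z) \<le> 1 - \<tau>"
      proof -
        have "\<zeta> \<bullet> (x - z) \<le> n * norm (x - z)" unfolding n_def by (rule norm_cauchy_schwarz)
        also have "\<dots> \<le> (1 / m) * (m / 2)" using x n_le m by (intro mult_mono) (auto simp: dist_norm norm_minus_commute)
        finally show ?thesis using m \<tau> by simp
      qed
      then have "\<nu> \<bullet> x \<le> c" using cut[of x] by linarith
      ultimately show "x \<in> K \<inter> {x. \<nu> \<bullet> x \<le> c}" by simp
    qed
    then have "ball z (m / 2) \<subseteq> interior (K \<inter> {x. \<nu> \<bullet> x \<le> c})" by (simp add: interior_maximal)
    moreover have "z \<in> ball z (m / 2)" using m by simp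
    ultimately show "interior (K \<inter> {x. \<nu> \<bullet> x \<le> c}) \<noteq> {}" by blast
  qed
  \<comment> \<open>The height is linear in \<open>r\<close> and its bound quadratic, so one factor
    \<open>r\<close> cancels.\<close>
  then have "r * (lam * m) \<le> r * (128 * real DIM('a) * \<Lambda> * C1\<^sup>2 * r)"
    by (simp add: power_mult_distrib power2_eq_square algebra_simps)
  then have "lam * m \<le> 128 * real DIM('a) * \<Lambda> * C1\<^sup>2 * r" using r by simp
  then show ?thesis using m unfolding lam_def by (simp add: field_simps)
qed

text \<open>Below a threshold \<open>r0\<close> depending only on the data, \<open>polar_gap\<close>
  applies, with the volume of \<open>K\<close> bounded by that of the outer ball. Above it the
  trivial bound \<open>2 / m\<close> is already linear in \<open>r\<close>.\<close>

lemma polar_gap_uniform: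
  fixes \<Lambda> \<epsilon> m M :: real
  assumes "\<Lambda> > 0" "\<epsilon> > 0" "0 < m" "0 < M"
  obtains C where "C > 0"
    "\<And>(K::'a::euclidean_space set) z \<xi>0 \<xi>1 x0 x1 r. qmpcc \<Lambda> \<epsilon> K \<Longrightarrow> ball z m \<subseteq> K \<Longrightarrow> K \<subseteq> ball z M \<Longrightarrow>
      \<xi>0 \<in> polar z K \<Longrightarrow> \<xi>1 \<in> polar z K \<Longrightarrow> z + x0 \<in> K \<Longrightarrow> \<xi>0 \<bullet> x0 = 1 \<Longrightarrow> \<xi>0 \<bullet> x1 \<le> \<xi>1 \<bullet> x1 \<Longrightarrow>
      norm (x0 - x1) \<le> r \<Longrightarrow> 0 < r \<Longrightarrow> norm (\<xi>1 - \<xi>0) \<le> C * r"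
proof -
  define C1 where "C1 = (2 + 4 * M / m) * ((4 * M + 2 * m) / m)"
  define V where "V = measure lebesgue (ball (0::'a) M)"
  define N where "N = real DIM('a)"
  \<comment> \<open>One entry per smallness condition of \<open>polar_gap\<close>. The factor 16 in
    place of 8 gives strictness, and \<open>V + 1\<close> keeps the denominator positive.\<close>
  define r0 where "r0 = min (m / 4) (min (1 / (16 * \<Lambda> * C1)) (m * \<epsilon> / (2 * N * (V + 1))))"
  have C1: "C1 > 0" unfolding C1_def using assms by (intro mult_pos_pos add_pos_pos divide_pos_pos) auto
  have V: "V \<ge> 0" by (simp add: V_def)
  have N: "N > 0" by (simp add: N_def)
  have r0: "r0 > 0" using assms C1 V N by (simp add: r0_def)
  define C where "C = 128 * N * \<Lambda> * C1\<^sup>2 / m + 2 / (m * r0)"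
  have Cp: "128 * N * \<Lambda> * C1\<^sup>2 / m > 0" "2 / (m * r0) > 0" using assms C1 N r0 by simp_all
  show thesis
  proof
    show "C > 0" unfolding C_def using Cp by (rule add_pos_pos)
    fix K :: "'a set" and z \<xi>0 \<xi>1 x0 x1 and r :: real
    assume qm: "qmpcc \<Lambda> \<epsilon> K" and zm: "ball z m \<subseteq> K" and zM: "K \<subseteq> ball z M"
      and \<xi>: "\<xi>0 \<in> polar z K" "\<xi>1 \<in> polar z K" and x: "z + x0 \<in> K" "\<xi>0 \<bullet> x0 = 1" "\<xi>0 \<bullet> x1 \<le> \<xi>1 \<bullet> x1"
      and r: "norm (x0 - x1) \<le> r" "0 < r"
    have K: "compact K" using qm by (simp add: qmpcc_def convex_body_def)
    show "norm (\<xi>1 - \<xi>0) \<le> C * r"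
    proof (cases "r \<le> r0")
      case True
      have r4: "r \<le> m / 4" and ra: "r \<le> 1 / (16 * \<Lambda> * C1)" and rb: "r \<le> m * \<epsilon> / (2 * N * (V + 1))"
        using True by (simp_all add: r0_def)
      have "16 * \<Lambda> * C1 * r \<le> 1" using ra assms C1 by (simp add: field_simps)
      then have s1: "8 * \<Lambda> * (C1 * r) < 1" by (simp add: mult_ac)
      have "ball z M = (+) z ` ball 0 M" using ball_translation[of z 0 M] by simp
      then have "measure lebesgue (ball z M) = V"
        unfolding V_def using measure_translation[of z "ball 0 M"] by metis
      then have KV: "measure lebesgue K \<le> V"
        using measure_mono_fmeasurable[OF zM] K lmeasurable_compact fmeasurableD lmeasurable_ball by metis
      have "0 < 2 * N * (V + 1)" using N V by simp
      then have "r * (2 * N * (V + 1)) \<le> m * \<epsilon>" using rb by (simp only: pos_le_divide_eq)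
      then have "N * (2 * r / m) * (V + 1) \<le> \<epsilon>" using assms by (simp add: field_simps)
      moreover have "N * (2 * r / m) * measure lebesgue K \<le> N * (2 * r / m) * (V + 1)"
        using KV N r assms by (intro mult_left_mono) auto
      ultimately have s2: "N * (2 * r / m) * measure lebesgue K \<le> \<epsilon>" by linarith
      have "norm (\<xi>1 - \<xi>0) \<le> 128 * N * \<Lambda> * C1\<^sup>2 / m * r"
        using polar_gap[OF qm assms(1,3) zm zM assms(4) \<xi> x r r4] s1 s2 unfolding C1_def N_def by blast
      also have "\<dots> \<le> C * r" using Cp r unfolding C_def by (intro mult_right_mono) auto
      finally show ?thesis .
    next
      case False
      have "norm (\<xi>1 - \<xi>0) \<le> norm \<xi>1 + norm \<xi>0" by (rule norm_triangle_ineq4)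
      also have "\<dots> \<le> 1 / m + 1 / m"
        by (intro add_mono norm_polar_le[OF compact_imp_closed[OF K] zm assms(3)] \<xi>)
      also have "\<dots> = 2 / (m * r0) * r0" using r0 by simp
      also have "\<dots> \<le> C * r" using Cp r r0 False unfolding C_def by (intro mult_mono) auto
      finally show ?thesis .
    qed
  qed
qed

section \<open>The gauge and its derivative\<close>

definition support_vec :: "'a::euclidean_space \<Rightarrow> 'a set \<Rightarrow> 'a \<Rightarrow> 'a" where
  "support_vec z K v = (SOME \<xi>. \<xi> \<in> polar z K \<and> (\<forall>\<zeta>\<in>polar z K. \<zeta> \<bullet> v \<le> \<xi> \<bullet> v))"

text \<open>By the bipolar theorem this is the Minkowski gauge of \<open>K - z\<close>.\<close>
definition polar_gauge :: "'a::euclidean_space \<Rightarrow> 'a set \<Rightarrow> 'a \<Rightarrow> real" where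
  "polar_gauge z K v = support_vec z K v \<bullet> v"

text \<open>The polar body is compact and contains 0, so the maximum behind the choice is
  attained.\<close>

lemma support_vec:
  assumes "closed K" "ball z m \<subseteq> K" "m > 0"
  shows "support_vec z K v \<in> polar z K"
    and "\<And>\<zeta>. \<zeta> \<in> polar z K \<Longrightarrow> \<zeta> \<bullet> v \<le> polar_gauge z K v"
proof -
  have "0 \<in> polar z K" by (simp add: polar_def)
  moreover have "continuous_on (polar z K) (\<lambda>\<xi>. \<xi> \<bullet> v)" by (intro continuous_intros)
  ultimately obtain \<xi> where "\<xi> \<in> polar z K" "\<forall>\<zeta>\<in>polar z K. \<zeta> \<bullet> v \<le> \<xi> \<bullet> v"
    using continuous_attains_sup[OF compact_polar[OF assms], of "\<lambda>\<xi>. \<xi> \<bullet> v"] by blast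
  then have "support_vec z K v \<in> polar z K \<and> (\<forall>\<zeta>\<in>polar z K. \<zeta> \<bullet> v \<le> support_vec z K v \<bullet> v)"
    unfolding support_vec_def by (intro someI[of "\<lambda>\<xi>. \<xi> \<in> polar z K \<and> (\<forall>\<zeta>\<in>polar z K. \<zeta> \<bullet> v \<le> \<xi> \<bullet> v)"]) blast
  then show "support_vec z K v \<in> polar z K" "\<And>\<zeta>. \<zeta> \<in> polar z K \<Longrightarrow> \<zeta> \<bullet> v \<le> polar_gauge z K v"
    by (auto simp: polar_gauge_def)
qed

lemma polar_gauge_scale:
  assumes "closed K" "ball z m \<subseteq> K" "m > 0" "t > 0"
  shows "polar_gauge z K (t *\<^sub>R v) = t * polar_gauge z K v"
proof (rule antisym)
  note s = support_vec[OF assms(1-3)]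
  show "polar_gauge z K (t *\<^sub>R v) \<le> t * polar_gauge z K v"
    using s(2)[OF s(1)[of "t *\<^sub>R v"], of v] assms(4) by (simp add: polar_gauge_def)
  show "t * polar_gauge z K v \<le> polar_gauge z K (t *\<^sub>R v)"
    using s(2)[OF s(1)[of v], of "t *\<^sub>R v"] by (simp add: polar_gauge_def[of z K v])
qed

text \<open>The vector of length \<open>1 / M\<close> in the direction of \<open>v\<close> lies in
  the polar body, because \<open>K\<close> lies in the outer ball.\<close>

lemma polar_gauge_ge:
  assumes "closed K" "ball z m \<subseteq> K" "m > 0" "K \<subseteq> ball z M"
  shows "norm v / M \<le> polar_gauge z K v"
proof (cases "v = 0")
  case False
  have "z \<in> K" using assms by auto
  then have M: "M > 0" using assms(4) by (force simp: subset_iff dist_norm intro: le_less_trans)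
  let ?\<xi> = "v /\<^sub>R (M * norm v)"
  have "?\<xi> \<bullet> (y - z) \<le> 1" if "y \<in> K" for y
  proof -
    have "v \<bullet> (y - z) \<le> norm v * norm (y - z)" by (rule norm_cauchy_schwarz)
    also have "\<dots> \<le> norm v * M" using assms(4) that by (intro mult_left_mono) (auto simp: dist_norm norm_minus_commute)
    finally show ?thesis using M False by (simp add: field_simps)
  qed
  then have "?\<xi> \<in> polar z K" by (simp add: polar_def)
  from support_vec(2)[OF assms(1-3) this, of v] show ?thesis
    using M False by (simp add: field_simps flip: power2_norm_eq_inner) (simp add: power2_eq_square)
qed (simp add: polar_gauge_def)

lemma polar_gauge_le_1_iff:
  assumes "closed K" "convex K" "ball z m \<subseteq> K" "m > 0"
  shows "z + v \<in> K \<longleftrightarrow> polar_gauge z K v \<le> 1"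
proof
  note s = support_vec[OF assms(1,3,4)]
  show "polar_gauge z K v \<le> 1" if "z + v \<in> K"
    using polarD[OF s(1) that, of v] by (simp add: polar_gauge_def)
  show "z + v \<in> K" if "polar_gauge z K v \<le> 1"
  proof (rule bipolar[OF assms(1,2)])
    show "z \<in> K" using assms(3,4) by auto
    show "\<xi> \<bullet> v \<le> 1" if "\<xi> \<in> polar z K" for \<xi>
      using s(2)[OF that, of v] \<open>polar_gauge z K v \<le> 1\<close> by simp
  qed
qed

text \<open>Maximality of the support vectors at \<open>x\<close> and at \<open>y\<close> places the
  linearisation error between 0 and
  \<open>(support_vec z K y - support_vec z K x) \<bullet> (y - x)\<close>, which is quadratic in
  the distance by \<open>lip\<close>.\<close>

lemma polar_gauge_has_derivative:
  assumes "closed K" "ball z m \<subseteq> K" "m > 0"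
    and lip: "\<And>y. norm (support_vec z K y - support_vec z K x) \<le> C * norm (y - x)"
  shows "(polar_gauge z K has_derivative (\<lambda>v. support_vec z K x \<bullet> v)) (at x)"
proof (rule has_derivativeI_sandwich[where e=1 and H="\<lambda>y. C * norm (y - x)"])
  show "bounded_linear (\<lambda>v. support_vec z K x \<bullet> v)" by (rule bounded_linear_inner_right)
  show "((\<lambda>y. C * norm (y - x)) \<longlongrightarrow> 0) (at x)" by (auto intro!: tendsto_eq_intros)
  fix y assume y: "y \<noteq> x"
  note s = support_vec[OF assms(1-3)]
  let ?d = "polar_gauge z K y - polar_gauge z K x - support_vec z K x \<bullet> (y - x)"
  let ?s = "support_vec z K y - support_vec z K x"
  have d0: "0 \<le> ?d" using s(2)[OF s(1)[of x], of y] by (simp add: polar_gauge_def[of z K x] inner_diff_right)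
  have "?d \<le> ?s \<bullet> (y - x)"
    using s(2)[OF s(1)[of y], of x]
    by (simp add: polar_gauge_def inner_diff_right inner_diff_left)
  also have "\<dots> \<le> norm ?s * norm (y - x)" by (rule norm_cauchy_schwarz)
  also have "\<dots> \<le> C * norm (y - x) * norm (y - x)" using lip[of y] by (intro mult_right_mono) auto
  finally show "norm ?d / norm (y - x) \<le> C * norm (y - x)" using d0 y by (simp add: pos_divide_le_eq)
qed simp

section \<open>From the gauge to the radial function\<close>

lemma reciprocal_diff_le:
  fixes p q :: real
  assumes "0 < p" "0 < q" "1 / p \<le> M" "1 / q \<le> M" "\<bar>p - q\<bar> \<le> d"
  shows "\<bar>1 / p - 1 / q\<bar> \<le> M\<^sup>2 * d" "\<bar>1 / p\<^sup>2 - 1 / q\<^sup>2\<bar> \<le> 2 * M ^ 3 * d"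
proof -
  have M: "0 \<le> M" using assms(1,3) by (meson order_trans zero_le_divide_1_iff less_imp_le)
  have "1 / p - 1 / q = (1 / p) * (1 / q) * (q - p)" using assms by (simp add: field_simps)
  then have "\<bar>1 / p - 1 / q\<bar> = (1 / p) * (1 / q) * \<bar>q - p\<bar>" using assms by (simp add: abs_mult)
  also have "\<dots> \<le> M * M * d" using assms M by (intro mult_mono) auto
  finally show 1: "\<bar>1 / p - 1 / q\<bar> \<le> M\<^sup>2 * d" by (simp add: power2_eq_square)
  have "1 / p\<^sup>2 - 1 / q\<^sup>2 = (1 / p + 1 / q) * (1 / p - 1 / q)"
    by (simp add: power2_eq_square algebra_simps)
  then have "\<bar>1 / p\<^sup>2 - 1 / q\<^sup>2\<bar> = \<bar>1 / p + 1 / q\<bar> * \<bar>1 / p - 1 / q\<bar>" by (simp add: abs_mult)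
  also have "\<dots> \<le> (2 * M) * (M\<^sup>2 * d)" using assms M 1 by (intro mult_mono) auto
  finally show "\<bar>1 / p\<^sup>2 - 1 / q\<^sup>2\<bar> \<le> 2 * M ^ 3 * d" by (simp add: power2_eq_square power3_eq_cube mult_ac)
qed

text \<open>For a gauge \<open>g\<close>, the function \<open>norm y / g y - 1\<close> is the
  0-homogeneous extension of \<open>1 / g - 1\<close>, whose derivative
  \<open>tangential_grad\<close> refers to.\<close>

lemma has_derivative_norm_div:
  fixes g :: "'a::euclidean_space \<Rightarrow> real"
  assumes "(g has_derivative (\<lambda>v. \<xi> \<bullet> v)) (at x)" "g x \<noteq> 0" "norm x = 1"
  shows "((\<lambda>y. norm y / g y - 1) has_derivative (\<lambda>v. (x /\<^sub>R g x - \<xi> /\<^sub>R (g x)\<^sup>2) \<bullet> v)) (at x)"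
proof -
  have "(norm has_derivative (\<lambda>v. v \<bullet> sgn x)) (at x)" using assms(3) by (intro has_derivative_norm) auto
  then have n: "(norm has_derivative (\<lambda>v. x \<bullet> v)) (at x)" using assms(3) by (simp add: sgn_div_norm inner_commute)
  have "((\<lambda>y. norm y / g y - 1) has_derivative
    (\<lambda>v. - norm x * (inverse (g x) * (\<xi> \<bullet> v) * inverse (g x)) + (x \<bullet> v) / g x - 0)) (at x)"
    by (intro has_derivative_diff has_derivative_divide has_derivative_const n assms)
  then show ?thesis
    using assms(2,3) by (simp add: inner_diff_left power2_eq_square divide_inverse mult_ac)
qed

theorem theorem4p2:
  fixes \<Lambda> \<epsilon> m M :: real
  assumes "DIM('a::euclidean_space) \<ge> 2"
    and "\<Lambda> > 0" and "\<epsilon> > 0" and "0 < m" and "m < M"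
  shows "\<exists>C>0. \<forall>(K::'a set) z.
           qmpcc \<Lambda> \<epsilon> K \<and> ball z m \<subseteq> K \<and> K \<subseteq> ball z M \<longrightarrow>
           (\<exists>h a. K = (\<lambda>y. a + y) ` {t *\<^sub>R ((1 + h x) *\<^sub>R x) | t x. t \<in> {0..1} \<and> x \<in> sphere 0 1}
                  \<and> C11_sphere_bound h C)"
proof -
  have M: "M > 0" using assms by simp
  obtain C0 where C0: "C0 > 0" and gap: "\<And>(K::'a set) z \<xi>0 \<xi>1 x0 x1 r. qmpcc \<Lambda> \<epsilon> K \<Longrightarrow> ball z m \<subseteq> K \<Longrightarrow> K \<subseteq> ball z M \<Longrightarrow>
      \<xi>0 \<in> polar z K \<Longrightarrow> \<xi>1 \<in> polar z K \<Longrightarrow> z + x0 \<in> K \<Longrightarrow> \<xi>0 \<bullet> x0 = 1 \<Longrightarrow> \<xi>0 \<bullet> x1 \<le> \<xi>1 \<bullet> x1 \<Longrightarrow>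
      norm (x0 - x1) \<le> r \<Longrightarrow> 0 < r \<Longrightarrow> norm (\<xi>1 - \<xi>0) \<le> C0 * r"
    using polar_gap_uniform[OF assms(2-4) M] by blast
  \<comment> \<open>Bounds on the sphere for \<open>h = 1 / g - 1\<close>, for its gradient
    \<open>x / g - \<xi> / g^2\<close>, and for the Lipschitz constant of that gradient. They use
    \<open>1 / g \<le> M\<close>, \<open>norm \<xi> \<le> 1 / m\<close> and the Lipschitz constant
    \<open>C0 * M\<close> of \<open>\<xi>\<close>.\<close>
  define A where "A = M + 1"
  define B where "B = M + M\<^sup>2 / m"
  define L where "L = M\<^sup>2 / m + M + 2 * M ^ 3 / m\<^sup>2 + M\<^sup>2 * (C0 * M)"
  have "A + B + L > 0" using assms M C0 unfolding A_def B_def L_def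
    by (intro add_pos_pos mult_pos_pos divide_pos_pos zero_less_power) auto
  moreover have "\<exists>h a. K = (\<lambda>y. a + y) ` {t *\<^sub>R ((1 + h x) *\<^sub>R x) | t x. t \<in> {0..1} \<and> x \<in> sphere 0 1}
                  \<and> C11_sphere_bound h (A + B + L)"
    if qm: "qmpcc \<Lambda> \<epsilon> K" and zm: "ball z m \<subseteq> K" and zM: "K \<subseteq> ball z M" for K :: "'a set" and z
  proof -
    have K: "compact K" "convex K" using qm by (auto simp: qmpcc_def convex_body_def)
    have cl: "closed K" using K(1) by (rule compact_imp_closed)
    define g where "g = polar_gauge z K"
    define \<xi> where "\<xi> = support_vec z K"
    note sv = support_vec[OF cl zm assms(4), folded g_def \<xi>_def]
    have g_eq: "g v = \<xi> v \<bullet> v" for v by (simp add: g_def \<xi>_def polar_gauge_def)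
    have g_scale: "g (t *\<^sub>R v) = t * g v" if "t > 0" for t v
      unfolding g_def by (rule polar_gauge_scale[OF cl zm assms(4) that])
    have g_ge: "norm v / M \<le> g v" for v
      unfolding g_def by (rule polar_gauge_ge[OF cl zm assms(4) zM])
    have inK: "z + v \<in> K \<longleftrightarrow> g v \<le> 1" for v
      unfolding g_def by (rule polar_gauge_le_1_iff[OF cl K(2) zm assms(4)])
    have g_pos: "0 < g v" if "v \<noteq> 0" for v
      using g_ge[of v] M that by (smt (verit) divide_pos_pos zero_less_norm_iff)
    have n\<xi>: "norm (\<xi> v) \<le> 1 / m" for v by (rule norm_polar_le[OF cl zm assms(4) sv(1)])
    have g_lip1: "g x - g y \<le> norm (x - y) / m" for x y
    proof -
      have "g x - g y \<le> \<xi> x \<bullet> (x - y)" using sv(2)[OF sv(1)[of x], of y] by (simp add: g_eq[of x] inner_diff_right)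
      also have "\<dots> \<le> norm (\<xi> x) * norm (x - y)" by (rule norm_cauchy_schwarz)
      also have "\<dots> \<le> (1 / m) * norm (x - y)" using n\<xi> by (intro mult_right_mono) auto
      finally show ?thesis by simp
    qed
    have g_lip: "\<bar>g x - g y\<bar> \<le> norm (x - y) / m" for x y
      using g_lip1[of x y] g_lip1[of y x] by (simp add: abs_le_iff norm_minus_commute)
    have gS: "0 < g x" "1 / g x \<le> M" if "norm x = 1" for x
    proof -
      show "0 < g x" using that by (intro g_pos) auto
      then show "1 / g x \<le> M" using g_ge[of x] that M by (simp add: field_simps)
    qed
    \<comment> \<open>Scaling by \<open>1 / g x\<close> moves \<open>x\<close> to gauge 1, as
      \<open>gap\<close> requires. The comparison of \<open>\<xi> x\<close> and
      \<open>\<xi> y\<close> at \<open>y\<close> survives, and distances grow by a factor of at most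
      \<open>M\<close>.\<close>
    have \<xi>_lip: "norm (\<xi> y - \<xi> x) \<le> C0 * M * norm (y - x)" if x: "norm x = 1" for x y
    proof (cases "y = x")
      case False
      note gx = gS[OF x]
      have "norm (\<xi> y - \<xi> x) \<le> C0 * (M * norm (y - x))"
      proof (rule gap[OF qm zm zM sv(1)[of x] sv(1)[of y], of "x /\<^sub>R g x" "y /\<^sub>R g x"])
        show "z + x /\<^sub>R g x \<in> K" using gx by (simp add: inK g_scale)
        show "\<xi> x \<bullet> (x /\<^sub>R g x) = 1" using gx by (simp add: g_eq[symmetric])
        have "\<xi> x \<bullet> y \<le> \<xi> y \<bullet> y" using sv(2)[OF sv(1)[of x], of y] by (simp add: g_eq)
        then show "\<xi> x \<bullet> (y /\<^sub>R g x) \<le> \<xi> y \<bullet> (y /\<^sub>R g x)" using gx by (simp add: mult_left_mono)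
        have "norm (x /\<^sub>R g x - y /\<^sub>R g x) = (1 / g x) * norm (y - x)"
          using gx by (simp add: norm_minus_commute divide_inverse flip: scaleR_diff_right)
        also have "\<dots> \<le> M * norm (y - x)" using gx by (intro mult_right_mono) auto
        finally show "norm (x /\<^sub>R g x - y /\<^sub>R g x) \<le> M * norm (y - x)" .
        show "0 < M * norm (y - x)" using M False by simp
      qed
      then show ?thesis by (simp add: mult.assoc)
    qed simp
    define h where "h x = 1 / g x - 1" for x
    define G where "G x = x /\<^sub>R g x - \<xi> x /\<^sub>R (g x)\<^sup>2" for x
    have der: "((\<lambda>y. h (y /\<^sub>R norm y)) has_derivative (\<lambda>v. G x \<bullet> v)) (at x)" if x: "norm x = 1" for x
    proof (rule has_derivative_transform_within_open[where s="- {0}"])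
      have "(g has_derivative (\<lambda>v. \<xi> x \<bullet> v)) (at x)"
        unfolding g_def \<xi>_def using \<xi>_lip[OF x, unfolded \<xi>_def]
        by (rule polar_gauge_has_derivative[OF cl zm assms(4)])
      then show "((\<lambda>y. norm y / g y - 1) has_derivative (\<lambda>v. G x \<bullet> v)) (at x)"
        unfolding G_def using gS[OF x] x by (intro has_derivative_norm_div) auto
      show "open (- {0::'a})" by (simp add: open_Compl)
      show "x \<in> - {0}" using x by auto
      fix y :: 'a assume "y \<in> - {0}"
      then show "norm y / g y - 1 = h (y /\<^sub>R norm y)" by (simp add: h_def g_scale divide_inverse)
    qed
    have tg: "tangential_grad h x = G x" if "norm x = 1" for x
      unfolding tangential_grad_def frechet_derivative_at[OF der[OF that], symmetric]
      by (rule euclidean_representation)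
    \<comment> \<open>Supplies all three witnesses in one introduction rule, so that the conjuncts
      split in a single pass.\<close>
    have ex3: "\<exists>a b c. P a b c" if "P A B L" for P :: "real \<Rightarrow> real \<Rightarrow> real \<Rightarrow> bool"
      using that by blast
    have C11: "C11_sphere_bound h (A + B + L)"
      unfolding C11_sphere_bound_def
    proof (intro conjI ballI ex3)
      show "A + B + L \<le> A + B + L" by simp
      fix x :: 'a assume "x \<in> sphere 0 1"
      then have x: "norm x = 1" by simp
      show "(\<lambda>y. h (y /\<^sub>R norm y)) differentiable at x" using der[OF x] by (rule differentiableI)
      show "\<bar>h x\<bar> \<le> A"
      proof -
        have "0 < 1 / g x" using gS[OF x] by simp
        then show ?thesis using gS(2)[OF x] M unfolding h_def A_def by linarith
      qed
      have gx2: "1 / (g x)\<^sup>2 \<le> M\<^sup>2"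
        using power_mono[OF gS(2)[OF x], of 2] gS(1)[OF x] by (simp add: power_divide)
      have "norm (G x) \<le> norm (x /\<^sub>R g x) + norm (\<xi> x /\<^sub>R (g x)\<^sup>2)" unfolding G_def by (rule norm_triangle_ineq4)
      also have "\<dots> = 1 / g x + 1 / (g x)\<^sup>2 * norm (\<xi> x)" using gS[OF x] x by (simp add: divide_inverse)
      also have "\<dots> \<le> M + M\<^sup>2 * (1 / m)" using gS[OF x] gx2 n\<xi>[of x] by (intro add_mono mult_mono) auto
      finally show "norm (tangential_grad h x) \<le> B" unfolding tg[OF x] B_def by simp
      fix y :: 'a assume "y \<in> sphere 0 1"
      then have y: "norm y = 1" by simp
      let ?d = "norm (x - y)"
      note rd = reciprocal_diff_le[OF gS(1)[OF x] gS(1)[OF y] gS(2)[OF x] gS(2)[OF y] g_lip]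
      have gy2: "1 / (g y)\<^sup>2 \<le> M\<^sup>2"
        using power_mono[OF gS(2)[OF y], of 2] gS(1)[OF y] by (simp add: power_divide)
      have tri: "norm ((p + q) - (u + w)) \<le> (norm p + norm q) + (norm u + norm w)" for p q u w :: 'a
        by (rule order_trans[OF norm_triangle_ineq4 add_mono[OF norm_triangle_ineq norm_triangle_ineq]])
      \<comment> \<open>Telescoping with one difference per term; the four terms give the four
        summands of \<open>L\<close> in this order.\<close>
      have "G x - G y = ((1 / g x - 1 / g y) *\<^sub>R x + (1 / g y) *\<^sub>R (x - y))
         - ((1 / (g x)\<^sup>2 - 1 / (g y)\<^sup>2) *\<^sub>R \<xi> x + (1 / (g y)\<^sup>2) *\<^sub>R (\<xi> x - \<xi> y))"
        by (simp add: G_def algebra_simps divide_inverse)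
      then have "norm (G x - G y) \<le> (\<bar>1 / g x - 1 / g y\<bar> * norm x + \<bar>1 / g y\<bar> * ?d)
         + (\<bar>1 / (g x)\<^sup>2 - 1 / (g y)\<^sup>2\<bar> * norm (\<xi> x) + \<bar>1 / (g y)\<^sup>2\<bar> * norm (\<xi> x - \<xi> y))"
        by (simp only: tri flip: norm_scaleR)
      also have "\<dots> \<le> (M\<^sup>2 * (?d / m) * 1 + M * ?d) + (2 * M ^ 3 * (?d / m) * (1 / m) + M\<^sup>2 * (C0 * M * ?d))"
        using rd gS[OF y] gy2 n\<xi>[of x] \<xi>_lip[OF y, of x] x M C0 assms
        by (intro add_mono mult_mono) auto
      also have "\<dots> = L * ?d" by (simp add: L_def algebra_simps power2_eq_square)
      finally show "norm (tangential_grad h x - tangential_grad h y) \<le> L * norm (x - y)"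
        unfolding tg[OF x] tg[OF y] .
    qed
    have "K = (\<lambda>y. z + y) ` {t *\<^sub>R ((1 + h x) *\<^sub>R x) | t x. t \<in> {0..1} \<and> x \<in> sphere 0 1}" (is "_ = _ ` ?S")
    proof (intro set_eqI iffI)
      fix y assume y: "y \<in> K"
      define v where "v = y - z"
      have gv: "g v \<le> 1" using inK[of v] y by (simp add: v_def)
      have "v \<in> ?S"
      proof (cases "v = 0")
        case True
        \<comment> \<open>At the centre \<open>t = 0\<close> works with any direction.\<close>
        obtain b :: 'a where "b \<in> Basis" using nonempty_Basis by blast
        then have "b \<in> sphere 0 1" by simp
        then show ?thesis using True by (intro CollectI exI[of _ 0] exI[of _ b]) auto
      next
        case False
        \<comment> \<open>The gauge is the parameter \<open>t\<close>, since \<open>1 + h\<close> in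
          the direction of \<open>v\<close> equals \<open>norm v / g v\<close>.\<close>
        have "v = g v *\<^sub>R ((1 + h (v /\<^sub>R norm v)) *\<^sub>R (v /\<^sub>R norm v))"
          using False g_pos[OF False] by (simp add: h_def g_scale)
        moreover have "g v \<in> {0..1}" "v /\<^sub>R norm v \<in> sphere 0 1" using gv g_pos[OF False] False by auto
        ultimately show ?thesis by blast
      qed
      then show "y \<in> (\<lambda>y. z + y) ` ?S" by (intro image_eqI[of _ _ v]) (simp add: v_def)
    next
      fix y assume "y \<in> (\<lambda>y. z + y) ` ?S"
      then obtain t x where tx: "y = z + t *\<^sub>R ((1 + h x) *\<^sub>R x)" "0 \<le> t" "t \<le> 1" "norm x = 1" by auto
      have "t *\<^sub>R ((1 + h x) *\<^sub>R x) = (t / g x) *\<^sub>R x" by (simp add: h_def)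
      moreover have "g ((t / g x) *\<^sub>R x) \<le> 1"
      proof (cases "t = 0")
        case True
        then show ?thesis by (simp add: g_eq)
      next
        case False
        then have "g ((t / g x) *\<^sub>R x) = t" using gS(1)[OF tx(4)] tx(2) by (simp add: g_scale)
        then show ?thesis using tx(3) by simp
      qed
      ultimately show "y \<in> K" unfolding tx(1) inK by (simp only:)
    qed
    with C11 show ?thesis by blast
  qed
  ultimately show ?thesis by blast
qed

end
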